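(* Let $q,r\in\mathbb{C}\setminus\{0\}$ with $q^k\neq 1$ for all positive integers $k$ and $r\neq \pm q^k$ for all $k\in\mathbb{Z}$. For any $n\geq 3$, the symmetrizers $S_n\in \mathrm{BWM}(r,q)_n$ and $S_{n-1}\in\mathrm{BWM}(r,q)_{n-1}\subset \mathrm{BWM}(r,q)_n$ satisfy $$S_n=\frac{1}{q^{n-1}[\![n]\!]}\,S_{n-1}\,b^+_{n-1,1}.$$
   Context: Let $q,r\in\mathbb{C}\setminus\{0\}$ with $q^k\neq1$ for all positive integers $k$ and $r\neq\pm q^k$ for all $k\in\mathbb{Z}$. Put $\hat q:=q-q^{-1}$ and $[\![k]\!]:=(q^k-q^{-k})/(q-q^{-1})$ for $k\in\mathbb{Z}$. For $n\ge 2$, the Birman--Wenzl--Murakami algebra $\mathrm{BWM}(r,q)_n$ is the unital $\mathbb{C}$-algebra generated by $g_i,e_i$, $i=1,\dots,n-1$, with relations (for all indices for which they make sense) $$g_ig_{i+1}g_i=g_{i+1}g_ig_{i+1},\qquad g_ig_j=g_jg_i\ \text{ for } |i-j|>1,$$ $$g_i^2=1+\hat q g_i-r^{-1}\hat q e_i,\qquad g_ie_i=e_ig_i=r^{-1}e_i,$$ $$g_ig_{i+1}e_i=e_{i+1}e_i,\qquad g_{i+1}g_ie_{i+1}=e_ie_{i+1}.$$ The algebra $\mathrm{BWM}(r,q)_{n}$ is naturally embedded into $\mathrm{BWM}(r,q)_{n+k}$, $k\ge0$, via $g_i\mapsto g_i$, $e_i\mapsto e_i$. The symmetrizer $S_n$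 ($n\ge 2$) is the unique nonzero element of $\mathrm{BWM}(r,q)_n$ such that $S_n^2=S_n$ and $S_ng_i=qS_n$ for all $i=1,\dots,n-1$ (its existence and uniqueness are known); it is central. For $1\le i<k$ define $$d^+_{k,i}:=e_{k-1}e_{k-2}\cdots e_i\sum_{j=0}^{i-1}q^j\, g_{i-1}g_{i-2}\cdots g_{i-j},$$ and for $0\le k<n$ define $$b^+_{k,1}:=\sum_{i=0}^kq^i\,g_kg_{k-1}\cdots g_{k+1-i}+\frac{\hat q}{1-q^{2k-1}r}\sum_{i=1}^kq^{2k-2i+1}d^+_{k+1,i}.$$ The product $g_{i-1}\cdots g_{i-j}$ has $j$ factors, the product $g_k\cdots g_{k+1-i}$ has $i$ factors, and empty products equal $1$. *)

theory Defs
  imports Complex_Main "HOL-Library.Poly_Mapping" "HOL-Algebra.QuotRing"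
begin

datatype bwm_gen = G nat | E nat

fun gen_index :: "bwm_gen \<Rightarrow> nat" where
  "gen_index (G i) = i"
| "gen_index (E i) = i"

text \<open>
  Words are wrapped in their own type so that concatenation can serve as the (additively
  written) monoid operation expected by \<^type>\<open>poly_mapping\<close>; then \<open>bwm_word \<Rightarrow>\<^sub>0 complex\<close>
  with its convolution product is the free unital associative algebra on all symbols
  \<open>G i\<close>, \<open>E i\<close>.
\<close>

datatype bwm_word = Word (letters: "bwm_gen list")

instantiation bwm_word :: monoid_add
begin

definition zero_bwm_word :: bwm_word where "0 = Word []"

definition plus_bwm_word :: "bwm_word \<Rightarrow> bwm_word \<Rightarrow> bwm_word" where
  "u + v = Word (letters u @ letters v)"

instance
  by standard (simp_all add: zero_bwm_word_def plus_bwm_word_def)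

end

type_synonym bwm_free = "bwm_word \<Rightarrow>\<^sub>0 complex"

definition free_scalar :: "complex \<Rightarrow> bwm_free" where
  "free_scalar c = Poly_Mapping.single 0 c"

definition free_g :: "nat \<Rightarrow> bwm_free" where
  "free_g i = Poly_Mapping.single (Word [G i]) 1"

definition free_e :: "nat \<Rightarrow> bwm_free" where
  "free_e i = Poly_Mapping.single (Word [E i]) 1"

definition free_carrier :: "nat \<Rightarrow> bwm_free set" where
  "free_carrier n =
     {p. \<forall>w \<in> Poly_Mapping.keys p. \<forall>a \<in> set (letters w). 1 \<le> gen_index a \<and> gen_index a < n}"

definition free_alg :: "nat \<Rightarrow> bwm_free ring" where
  "free_alg n = \<lparr>carrier = free_carrier n, monoid.mult = (*), one = 1,
                 ring.zero = 0, add = (+)\<rparr>"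

definition q_hat :: "complex \<Rightarrow> complex" where
  "q_hat q = q - inverse q"

definition q_num :: "complex \<Rightarrow> int \<Rightarrow> complex" where
  "q_num q k = (q powi k - q powi (- k)) / (q - inverse q)"

text \<open>A defining relation \<open>x = y\<close> is recorded as the element \<open>x - y\<close> of the free algebra.\<close>

definition bwm_relators :: "complex \<Rightarrow> complex \<Rightarrow> nat \<Rightarrow> bwm_free set" where
  "bwm_relators q r n =
     {free_g i * free_g (i + 1) * free_g i - free_g (i + 1) * free_g i * free_g (i + 1) | i.
        1 \<le> i \<and> i + 1 < n}
   \<union> {free_g i * free_g j - free_g j * free_g i | i j.
        1 \<le> i \<and> i < n \<and> 1 \<le> j \<and> j < n \<and> \<bar>int i - int j\<bar> > 1}
   \<union> {free_g i * free_g i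
        - (1 + free_scalar (q_hat q) * free_g i
             - free_scalar (inverse r * q_hat q) * free_e i) | i. 1 \<le> i \<and> i < n}
   \<union> {free_g i * free_e i - free_scalar (inverse r) * free_e i | i. 1 \<le> i \<and> i < n}
   \<union> {free_e i * free_g i - free_scalar (inverse r) * free_e i | i. 1 \<le> i \<and> i < n}
   \<union> {free_g i * free_g (i + 1) * free_e i - free_e (i + 1) * free_e i | i.
        1 \<le> i \<and> i + 1 < n}
   \<union> {free_g (i + 1) * free_g i * free_e (i + 1) - free_e i * free_e (i + 1) | i.
        1 \<le> i \<and> i + 1 < n}"

text \<open>
  \<^const>\<open>genideal\<close> yields two-sided ideals. As the ring \<^term>\<open>free_alg n\<close> contains the scalars
  centrally, its ring ideals are automatically subspaces, so the quotient ring is the quotient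
  algebra.
\<close>

definition bwm_ideal :: "complex \<Rightarrow> complex \<Rightarrow> nat \<Rightarrow> bwm_free set" where
  "bwm_ideal q r n = Idl\<^bsub>free_alg n\<^esub> (bwm_relators q r n)"

definition BWM :: "complex \<Rightarrow> complex \<Rightarrow> nat \<Rightarrow> bwm_free set ring" where
  "BWM q r n = free_alg n Quot bwm_ideal q r n"

definition bwm_class :: "complex \<Rightarrow> complex \<Rightarrow> nat \<Rightarrow> bwm_free \<Rightarrow> bwm_free set" where
  "bwm_class q r n x = bwm_ideal q r n +>\<^bsub>free_alg n\<^esub> x"

definition bwm_g :: "complex \<Rightarrow> complex \<Rightarrow> nat \<Rightarrow> nat \<Rightarrow> bwm_free set" where
  "bwm_g q r n i = bwm_class q r n (free_g i)"

definition bwm_e :: "complex \<Rightarrow> complex \<Rightarrow> nat \<Rightarrow> nat \<Rightarrow> bwm_free set" where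
  "bwm_e q r n i = bwm_class q r n (free_e i)"

definition bwm_scale ::
    "complex \<Rightarrow> complex \<Rightarrow> nat \<Rightarrow> complex \<Rightarrow> bwm_free set \<Rightarrow> bwm_free set" where
  "bwm_scale q r n c X = bwm_class q r n (free_scalar c) \<otimes>\<^bsub>BWM q r n\<^esub> X"

text \<open>
  The homomorphism from the algebra on \<open>m\<close> strands to that on \<open>n \<ge> m\<close> strands with
  \<open>g\<^sub>i \<mapsto> g\<^sub>i\<close> and \<open>e\<^sub>i \<mapsto> e\<^sub>i\<close>: all representatives of \<open>X\<close> have the same class in the larger
  algebra (see \<open>bwm_embed_class\<close> below).
\<close>

definition bwm_embed ::
    "complex \<Rightarrow> complex \<Rightarrow> nat \<Rightarrow> nat \<Rightarrow> bwm_free set \<Rightarrow> bwm_free set" where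
  "bwm_embed q r m n X = the_elem (bwm_class q r n ` X)"

definition is_symmetrizer :: "complex \<Rightarrow> complex \<Rightarrow> nat \<Rightarrow> bwm_free set \<Rightarrow> bool" where
  "is_symmetrizer q r n S \<longleftrightarrow>
     S \<in> carrier (BWM q r n) \<and> S \<noteq> \<zero>\<^bsub>BWM q r n\<^esub> \<and> S \<otimes>\<^bsub>BWM q r n\<^esub> S = S \<and>
     (\<forall>i. 1 \<le> i \<and> i < n \<longrightarrow> S \<otimes>\<^bsub>BWM q r n\<^esub> bwm_g q r n i = bwm_scale q r n q S)"

definition symmetrizer :: "complex \<Rightarrow> complex \<Rightarrow> nat \<Rightarrow> bwm_free set" where
  "symmetrizer q r n = (THE S. is_symmetrizer q r n S)"

text \<open>
  The descending product \<open>x\<^sub>b\<^sub>-\<^sub>1 \<cdots> x\<^sub>a\<close>, with \<open>b - a\<close> factors; it is \<open>\<one>\<close> for \<open>b \<le> a\<close>.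
\<close>

definition desc_prod :: "('a, 'b) ring_scheme \<Rightarrow> (nat \<Rightarrow> 'a) \<Rightarrow> nat \<Rightarrow> nat \<Rightarrow> 'a" where
  "desc_prod R x a b = foldr (\<lambda>i y. x i \<otimes>\<^bsub>R\<^esub> y) (rev [a..<b]) \<one>\<^bsub>R\<^esub>"

definition d_plus :: "complex \<Rightarrow> complex \<Rightarrow> nat \<Rightarrow> nat \<Rightarrow> nat \<Rightarrow> bwm_free set" where
  "d_plus q r n k i =
     desc_prod (BWM q r n) (bwm_e q r n) i k \<otimes>\<^bsub>BWM q r n\<^esub>
     (\<Oplus>\<^bsub>BWM q r n\<^esub>j\<in>{0..i - 1}.
        bwm_scale q r n (q ^ j) (desc_prod (BWM q r n) (bwm_g q r n) (i - j) i))"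

definition b_plus :: "complex \<Rightarrow> complex \<Rightarrow> nat \<Rightarrow> nat \<Rightarrow> bwm_free set" where
  "b_plus q r n k =
     (\<Oplus>\<^bsub>BWM q r n\<^esub>i\<in>{0..k}.
        bwm_scale q r n (q ^ i) (desc_prod (BWM q r n) (bwm_g q r n) (k + 1 - i) (k + 1)))
     \<oplus>\<^bsub>BWM q r n\<^esub>
     bwm_scale q r n (q_hat q / (1 - q powi (2 * int k - 1) * r))
       (\<Oplus>\<^bsub>BWM q r n\<^esub>i\<in>{1..k}.
          bwm_scale q r n (q powi (2 * int k - 2 * int i + 1)) (d_plus q r n (k + 1) i))"

lemma ring_free_alg: "ring (free_alg n)"
proof -
  have add: "x + y \<in> free_carrier n" if "x \<in> free_carrier n" "y \<in> free_carrier n" for x y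
    using that Poly_Mapping.keys_add[of x y] unfolding free_carrier_def by blast
  have neg: "- x \<in> free_carrier n" if "x \<in> free_carrier n" for x
    using that by (simp add: free_carrier_def)
  have mult: "x * y \<in> free_carrier n" if "x \<in> free_carrier n" "y \<in> free_carrier n" for x y
    using that Poly_Mapping.keys_mult[of x y]
    unfolding free_carrier_def plus_bwm_word_def by fastforce
  have zero: "0 \<in> free_carrier n" and one: "1 \<in> free_carrier n"
    by (simp_all add: free_carrier_def zero_bwm_word_def flip: single_one)
  show ?thesis
  proof (rule ringI)
    show "abelian_group (free_alg n)"
      by (rule abelian_groupI)
         (auto simp: free_alg_def add zero algebra_simps intro: neg bexI[of _ "- _"])
    show "monoid (free_alg n)"
      by (rule monoidI) (auto simp: free_alg_def mult one algebra_simps)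
  qed (auto simp: free_alg_def algebra_simps)
qed

lemma free_g_in_carrier: "1 \<le> i \<Longrightarrow> i < n \<Longrightarrow> free_g i \<in> free_carrier n"
  by (simp add: free_g_def free_carrier_def)

lemma free_e_in_carrier: "1 \<le> i \<Longrightarrow> i < n \<Longrightarrow> free_e i \<in> free_carrier n"
  by (simp add: free_e_def free_carrier_def)

lemma free_scalar_in_carrier: "free_scalar c \<in> free_carrier n"
  by (simp add: free_scalar_def free_carrier_def zero_bwm_word_def)

lemma free_carrier_mono: "m \<le> n \<Longrightarrow> free_carrier m \<subseteq> free_carrier n"
  by (force simp: free_carrier_def)

lemma minus_free_alg:
  assumes "x \<in> free_carrier n" "y \<in> free_carrier n"
  shows "x \<ominus>\<^bsub>free_alg n\<^esub> y = x - y"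
proof -
  interpret ring "free_alg n" by (rule ring_free_alg)
  have "- y \<in> free_carrier n"
    using assms by (simp add: free_carrier_def)
  then have "\<ominus>\<^bsub>free_alg n\<^esub> y = - y"
    using assms by (intro minus_equality) (simp_all add: free_alg_def)
  then show ?thesis
    by (simp add: a_minus_def) (simp add: free_alg_def)
qed

lemma bwm_relators_subset: "bwm_relators q r n \<subseteq> free_carrier n"
proof -
  interpret ring "free_alg n" by (rule ring_free_alg)
  have mult: "x * y \<in> free_carrier n" if "x \<in> free_carrier n" "y \<in> free_carrier n" for x y
    using m_closed[of x y] that by (simp add: free_alg_def)
  have add: "x + y \<in> free_carrier n" if "x \<in> free_carrier n" "y \<in> free_carrier n" for x y
    using a_closed[of x y] that by (simp add: free_alg_def)
  have minus: "x - y \<in> free_carrier n" if "x \<in> free_carrier n" "y \<in> free_carrier n" for x y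
    using minus_closed[of x y] minus_free_alg[of x n y] that by (simp add: free_alg_def)
  have one: "1 \<in> free_carrier n"
    using one_closed by (simp add: free_alg_def)
  note closed = mult add minus one free_g_in_carrier free_e_in_carrier free_scalar_in_carrier
  show ?thesis
    unfolding bwm_relators_def by (auto intro!: closed)
qed

lemma ideal_bwm_ideal: "ideal (bwm_ideal q r n) (free_alg n)"
  unfolding bwm_ideal_def
  using bwm_relators_subset by (intro ring.genideal_ideal ring_free_alg) (simp add: free_alg_def)

lemma ring_BWM: "ring (BWM q r n)"
  unfolding BWM_def by (rule ideal.quotient_is_ring[OF ideal_bwm_ideal])

lemma bwm_class_eq_iff:
  assumes "x \<in> free_carrier n" "y \<in> free_carrier n"
  shows "bwm_class q r n x = bwm_class q r n y \<longleftrightarrow> x - y \<in> bwm_ideal q r n"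
proof -
  have "x - y \<in> bwm_ideal q r n \<longleftrightarrow> x \<ominus>\<^bsub>free_alg n\<^esub> y \<in> bwm_ideal q r n"
    by (simp add: minus_free_alg assms)
  also have "\<dots> \<longleftrightarrow> bwm_class q r n x = bwm_class q r n y"
    unfolding bwm_class_def
    using ring.quotient_eq_iff_same_a_r_cos[OF ring_free_alg ideal_bwm_ideal] assms
    by (metis free_alg_def partial_object.select_convs(1))
  finally show ?thesis ..
qed

lemma bwm_ideal_mono:
  assumes "m \<le> n"
  shows "bwm_ideal q r m \<subseteq> bwm_ideal q r n"
proof -
  interpret M: ring "free_alg m" by (rule ring_free_alg)
  interpret N: ring "free_alg n" by (rule ring_free_alg)
  interpret I: ideal "bwm_ideal q r n" "free_alg n" by (rule ideal_bwm_ideal)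
  let ?J = "bwm_ideal q r n \<inter> free_carrier m"
  have sub: "free_carrier m \<subseteq> free_carrier n"
    by (rule free_carrier_mono[OF assms])
  have inv: "\<ominus>\<^bsub>free_alg k\<^esub> x = - x" if "x \<in> free_carrier k" for x k
  proof -
    interpret K: ring "free_alg k" by (rule ring_free_alg)
    show ?thesis
      using that by (intro K.minus_equality) (simp_all add: free_alg_def free_carrier_def)
  qed
  have "ideal ?J (free_alg m)"
  proof (rule idealI)
    show "ring (free_alg m)" by (rule ring_free_alg)
    show "subgroup ?J (add_monoid (free_alg m))"
    proof (rule M.add.subgroupI)
      show "?J \<subseteq> carrier (free_alg m)"
        by (simp add: free_alg_def)
      show "?J \<noteq> {}"
        using I.zero_closed M.zero_closed by (auto simp: free_alg_def)
    next
      fix x assume x: "x \<in> ?J"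
      then have "\<ominus>\<^bsub>free_alg n\<^esub> x \<in> bwm_ideal q r n"
        by (simp add: I.a_inv_closed)
      moreover have "\<ominus>\<^bsub>free_alg m\<^esub> x \<in> free_carrier m"
        using M.a_inv_closed[of x] x by (simp add: free_alg_def)
      ultimately have "\<ominus>\<^bsub>free_alg m\<^esub> x \<in> ?J"
        using x sub inv by (metis IntD2 IntI subsetD)
      then show "\<ominus>\<^bsub>free_alg m\<^esub> x \<in> ?J" .
    next
      fix x y assume "x \<in> ?J" "y \<in> ?J"
      then show "x \<oplus>\<^bsub>free_alg m\<^esub> y \<in> ?J"
        using I.a_closed[of x y] M.a_closed[of x y] by (simp add: free_alg_def)
    qed
  next
    fix a x assume "a \<in> ?J" "x \<in> carrier (free_alg m)"
    then have a: "a \<in> bwm_ideal q r n" "a \<in> free_carrier m" and x: "x \<in> free_carrier m"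
      by (auto simp: free_alg_def)
    have x': "x \<in> free_carrier n" using x sub by blast
    show "x \<otimes>\<^bsub>free_alg m\<^esub> a \<in> ?J"
      using I.I_l_closed[OF a(1)] M.m_closed[of x a] a x x' by (simp add: free_alg_def)
    show "a \<otimes>\<^bsub>free_alg m\<^esub> x \<in> ?J"
      using I.I_r_closed[OF a(1)] M.m_closed[of a x] a x x' by (simp add: free_alg_def)
  qed
  moreover have "bwm_relators q r m \<subseteq> ?J"
  proof -
    have "bwm_relators q r m \<subseteq> bwm_relators q r n"
      unfolding bwm_relators_def using assms by (intro Un_mono) fastforce+
    also have "\<dots> \<subseteq> bwm_ideal q r n"
      unfolding bwm_ideal_def using bwm_relators_subset
      by (intro N.genideal_self) (simp add: free_alg_def)
    finally show ?thesis using bwm_relators_subset by blast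
  qed
  ultimately have "bwm_ideal q r m \<subseteq> ?J"
    unfolding bwm_ideal_def[of q r m] by (rule M.genideal_minimal)
  then show ?thesis by blast
qed

lemma bwm_embed_class:
  assumes "m \<le> n" "x \<in> free_carrier m"
  shows "bwm_embed q r m n (bwm_class q r m x) = bwm_class q r n x"
proof -
  interpret M: ring "free_alg m" by (rule ring_free_alg)
  interpret I: ideal "bwm_ideal q r m" "free_alg m" by (rule ideal_bwm_ideal)
  have x: "x \<in> carrier (free_alg m)"
    using assms by (simp add: free_alg_def)
  have "bwm_class q r n y = bwm_class q r n x" if y_in: "y \<in> bwm_class q r m x" for y
  proof -
    have "bwm_class q r m x = (\<Union>h\<in>bwm_ideal q r m. {h + x})"
      unfolding bwm_class_def a_r_coset_def' by (simp add: free_alg_def)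
    then obtain h where h: "h \<in> bwm_ideal q r m" and y: "y = h + x"
      using y_in by auto
    have "h \<in> free_carrier m"
      using h I.a_subset by (auto simp: free_alg_def)
    then have "h + x \<in> free_carrier m"
      using M.a_closed[of h x] assms by (simp add: free_alg_def)
    then show ?thesis
      using h y assms bwm_ideal_mono[OF assms(1)] free_carrier_mono[OF assms(1)]
      by (subst bwm_class_eq_iff) auto
  qed
  moreover have "x \<in> bwm_class q r m x"
    unfolding bwm_class_def by (rule I.a_rcos_self[OF x])
  ultimately have "bwm_class q r n ` bwm_class q r m x = {bwm_class q r n x}"
    by blast
  then show ?thesis by (simp add: bwm_embed_def)
qed

end

theory Submission
  imports Defs
begin

text \<open>
  Let \<open>\<chi>\<close> be the character \<open>g\<^sub>i \<mapsto> q\<close>, \<open>e\<^sub>i \<mapsto> 0\<close> of the algebra. If \<open>t g\<^sub>i = q t\<close> for all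
  \<open>i\<close>, then \<open>t e\<^sub>i = 0\<close>, since \<open>q t e\<^sub>i = t g\<^sub>i e\<^sub>i = inverse r t e\<^sub>i\<close> and \<open>q r \<noteq> 1\<close>; hence
  \<open>t x = \<chi>(x) t\<close> for all \<open>x\<close>. In the same way \<open>x l = \<chi>(x) l\<close> for every \<open>l\<close> that is invariant from
  the left. If \<open>\<chi>(t) = \<chi>(l) = 1\<close>, evaluating \<open>t l\<close> in both ways gives \<open>t = l\<close>. So as soon as
  a left invariant element of weight one exists, the symmetrizer is the only right invariant
  element of weight one (\<open>symmetrizer_eq\<close>), and the recursion follows once
  \<open>S\<^sub>n\<^sub>-\<^sub>1 b\<close> is shown to be right invariant and its weight is computed.

  The invariance is a statement about a vector \<open>x\<close> with \<open>x g\<^sub>i = q x\<close> for \<open>i < k\<close> in an arbitrary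
  right module. The factor \<open>b\<close> has a part \<open>B\<^sub>k\<close> built from the \<open>g\<^sub>i\<close> alone and a part \<open>D\<^sub>k\<close> built from
  words \<open>e\<^sub>k \<cdots> e\<^sub>i\<close>, and with \<open>k' = k + 1\<close> they satisfy
  \<open>x B\<^sub>k\<^sub>' = x + q (x g\<^sub>k\<^sub>') B\<^sub>k\<close> and \<open>x D\<^sub>k\<^sub>' = q (x e\<^sub>k\<^sub>') B\<^sub>k + q\<^sup>2 (x e\<^sub>k\<^sub>') D\<^sub>k\<close>.
  Induction along these recursions shows that both \<open>x B\<^sub>k (g\<^sub>j - q)\<close> and \<open>x D\<^sub>k (g\<^sub>j - q)\<close> are explicit
  multiples of the single vector \<open>x e\<^sub>k e\<^sub>k\<^sub>-\<^sub>1 \<cdots> e\<^sub>j\<close>, with coefficients that do not depend on \<open>j\<close>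
  (\<open>G_coset_sum\<close>, \<open>G_contraction_sum\<close>). The coefficient in front of \<open>D\<^sub>k\<close> in \<open>b\<close> is the one for
  which they cancel (\<open>G_symmetrize\<close>).

  Starting from the unit and applying the factors one after the other produces invariant elements
  of weight one. The defining relations imply their mirror images (\<open>braid_E\<close>), so left
  multiplication satisfies the same conditions as right multiplication, and the same argument also
  yields the left invariant element needed for uniqueness.

  For the module computations, the quotient of the free algebra is replaced by a linear complement
  of the ideal. The generators then act by linear operators on the vector space
  \<^typ>\<open>bwm_free\<close>, and identities between vectors are proved by linear algebra on a type.
\<close>

section \<open>Modules with braid and contraction operators\<close>

text \<open>
  Right multiplication and left multiplication by the generators compose in opposite orders. The
  conditions collected here read the same in both orders, and \<open>braid_E\<close> uses nothing else, so both
  multiplications can be treated at once. Words in comments follow the case of right multiplication,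
  where \<open>G i\<close> is \<open>x \<mapsto> x g\<^sub>i\<close> and \<open>E i (G j x)\<close> is \<open>x g\<^sub>j e\<^sub>i\<close>.
\<close>

locale braid_operators = vector_space scale
  for scale :: "'k::field \<Rightarrow> 'v::ab_group_add \<Rightarrow> 'v" (infixr "*s" 75) +
  fixes G E :: "nat \<Rightarrow> 'v \<Rightarrow> 'v" and q r :: 'k and n :: nat
  assumes G_add: "G i (x + y) = G i x + G i y"
    and G_scale: "G i (c *s x) = c *s G i x"
    and braid: "1 \<le> i \<Longrightarrow> Suc i < n \<Longrightarrow> G i (G (Suc i) (G i x)) = G (Suc i) (G i (G (Suc i) x))"
    and G_far: "1 \<le> i \<Longrightarrow> Suc i < j \<Longrightarrow> j < n \<Longrightarrow> G j (G i x) = G i (G j x)"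
    and G_quadratic: "1 \<le> i \<Longrightarrow> i < n \<Longrightarrow>
          G i (G i x) = x + (q - inverse q) *s G i x - (inverse r * (q - inverse q)) *s E i x"
    and E_add: "E i (x + y) = E i x + E i y"
    and E_scale: "E i (c *s x) = c *s E i x"
    and GE: "1 \<le> i \<Longrightarrow> i < n \<Longrightarrow> G i (E i x) = inverse r *s E i x"
    and EG: "1 \<le> i \<Longrightarrow> i < n \<Longrightarrow> E i (G i x) = inverse r *s E i x"
    and q_nonzero: "q \<noteq> 0" and r_nonzero: "r \<noteq> 0"
    and q_nonroot: "k > 0 \<Longrightarrow> q ^ k \<noteq> 1"
begin

lemma q_hat_nonzero: "q - inverse q \<noteq> 0"
  using q_nonroot[of 2] q_nonzero by (simp add: field_simps power2_eq_square)

lemma G_diff: "G i (x - y) = G i x - G i y"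
  by (metis G_add add_diff_cancel_right' diff_add_cancel)

lemma E_diff: "E i (x - y) = E i x - E i y"
  by (metis E_add add_diff_cancel_right' diff_add_cancel)

lemma G_zero: "G i 0 = 0" and E_zero: "E i 0 = 0"
  using G_scale[of i 0 0] E_scale[of i 0 0] by simp_all

lemmas linear_simps = G_add G_diff G_scale G_zero E_add E_diff E_scale E_zero

text \<open>
  As \<open>q - inverse q\<close> is invertible, \<open>e\<^sub>i\<close> is a polynomial in \<open>g\<^sub>i\<close>; this is how properties of
  the \<open>g\<^sub>i\<close> are passed on to the \<open>e\<^sub>i\<close>.
\<close>

lemma E_eq:
  assumes "1 \<le> i" "i < n"
  shows "E i x = (r / (q - inverse q)) *s (x + (q - inverse q) *s G i x - G i (G i x))"
  using G_quadratic[OF assms, of x] q_hat_nonzero r_nonzero by (simp add: right_inverse)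

lemma GE_far: "1 \<le> i \<Longrightarrow> Suc i < j \<Longrightarrow> j < n \<Longrightarrow> G j (E i x) = E i (G j x)"
  by (simp add: E_eq linear_simps G_far)

lemma EG_far: "1 \<le> i \<Longrightarrow> Suc i < j \<Longrightarrow> j < n \<Longrightarrow> E j (G i x) = G i (E j x)"
  by (simp add: E_eq linear_simps G_far)

text \<open>
  The braid relation conjugates \<open>g\<^sub>i\<close> into \<open>g\<close> at the neighbouring index, hence any polynomial in
  \<open>g\<^sub>i\<close> as well. This turns \<open>g\<^sub>i g\<^sub>i\<^sub>+\<^sub>1 e\<^sub>i = e\<^sub>i\<^sub>+\<^sub>1 e\<^sub>i\<close> into its mirror image and makes the
  presentation stable under reversing words.
\<close>

lemma braid_E:
  assumes "1 \<le> i" "Suc i < n"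
  shows "G i (G (Suc i) (E i x)) = E (Suc i) (G i (G (Suc i) x))"
    and "G (Suc i) (G i (E (Suc i) x)) = E i (G (Suc i) (G i x))"
  using assms by (simp_all add: E_eq linear_simps braid)

end

locale bwm_operators = braid_operators scale G E q r n
  for scale :: "'k::field \<Rightarrow> 'v::ab_group_add \<Rightarrow> 'v" (infixr "*s" 75) and G E q r n +
  assumes EE_up: "1 \<le> i \<Longrightarrow> Suc i < n \<Longrightarrow> G i (G (Suc i) (E i x)) = E (Suc i) (E i x)"
    and EE_down: "1 \<le> i \<Longrightarrow> Suc i < n \<Longrightarrow> G (Suc i) (G i (E (Suc i) x)) = E i (E (Suc i) x)"
    and r_generic: "r * q ^ Suc (2 * k) \<noteq> 1"
begin

lemma EGG:
  assumes "1 \<le> i" "Suc i < n"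
  shows "E (Suc i) (G i (G (Suc i) x)) = E (Suc i) (E i x)"
    and "E i (G (Suc i) (G i x)) = E i (E (Suc i) x)"
  using assms by (simp_all flip: EE_up EE_down add: braid_E)

lemma E_eq_0_if_invariant:
  assumes "1 \<le> i" "i < n" "G i x = q *s x"
  shows "E i x = 0"
proof -
  have "q *s E i x = inverse r *s E i x"
    using EG[OF assms(1,2), of x] by (simp add: assms(3) linear_simps)
  then have "(q - inverse r) *s E i x = 0" by (simp add: scale_left_diff_distrib)
  moreover have "q \<noteq> inverse r"
    using r_generic[of 0] r_nonzero by (auto simp: field_simps)
  ultimately show ?thesis by simp
qed

lemma E_E_invariant:
  assumes "1 \<le> i" "Suc i < n" "G i x = q *s x"
  shows "E i (E (Suc i) x) = q *s E i (G (Suc i) x)"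
  using EGG(2)[OF assms(1,2), of x] by (simp add: assms(3) linear_simps)

lemma E_G_E:
  assumes "1 \<le> i" "Suc i < n"
  shows "E (Suc i) (G i (E (Suc i) x)) = r *s E (Suc i) (E i (E (Suc i) x))"
  using EGG(1)[OF assms, of "E (Suc i) x", symmetric] assms r_nonzero by (simp add: GE linear_simps)

text \<open>
  The relation \<open>e\<^sub>k e\<^sub>k\<^sub>-\<^sub>1 e\<^sub>k = e\<^sub>k\<close> is not part of the presentation. Behind a vector \<open>x\<close> with
  \<open>x g\<^sub>k\<^sub>-\<^sub>1 = q x\<close> it can be derived: push \<open>x e\<^sub>k e\<^sub>k\<^sub>-\<^sub>1 = q x g\<^sub>k e\<^sub>k\<^sub>-\<^sub>1\<close> into the word and expand
  \<open>g\<^sub>k g\<^sub>k\<close>. The word comes back with coefficient \<open>- q (q - inverse q)\<close>, and the factor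
  \<open>1 + q (q - inverse q) = q\<^sup>2\<close> that results can be cancelled.
\<close>

lemma E_E_E_invariant:
  assumes i: "1 \<le> i" "Suc i < n" and inv: "G i x = q *s x"
  shows "E (Suc i) (E i (E (Suc i) x)) = E (Suc i) x"
proof -
  let ?z = "E (Suc i) (E i (E (Suc i) x))" and ?h = "q - inverse q"
  have i': "i < n" using i by simp
  note inv' = inv E_eq_0_if_invariant[OF i(1) i' inv]
  have "?z = q *s E (Suc i) (G i (G (Suc i) (G (Suc i) x)))"
    using i by (simp add: E_E_invariant[OF i inv] EGG(1) linear_simps)
  also have "\<dots> = (q * q) *s E (Suc i) x - (q * ?h) *s ?z"
    using i r_nonzero E_G_E[OF i, of x]
    by (simp add: G_quadratic[of "Suc i"] linear_simps inv' EGG(1) scale_right_distrib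
        scale_right_diff_distrib)
  finally have "(1 + q * ?h) *s ?z = (q * q) *s E (Suc i) x"
    by (simp add: scale_left_distrib algebra_simps)
  moreover have "1 + q * ?h = q * q" using q_nonzero by (simp add: algebra_simps)
  ultimately show ?thesis using q_nonzero by simp
qed

text \<open>
  In terms of the inverse braid generator this is \<open>x e\<^sub>k e\<^sub>k\<^sub>-\<^sub>1 g\<^sub>k = x e\<^sub>k inverse(g\<^sub>k\<^sub>-\<^sub>1)\<close>.
\<close>

lemma G_E_E_invariant:
  assumes i: "1 \<le> i" "Suc i < n" and inv: "G i x = q *s x"
  shows "G (Suc i) (E i (E (Suc i) x)) =
    G i (E (Suc i) x) + (q - inverse q) *s E i (E (Suc i) x) - (q - inverse q) *s E (Suc i) x"
proof -
  have "G (Suc i) (E i (E (Suc i) x)) = G (Suc i) (G (Suc i) (G i (E (Suc i) x)))"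
    using i by (simp flip: EE_down)
  also have "\<dots> = G i (E (Suc i) x) + (q - inverse q) *s E i (E (Suc i) x)
      - (q - inverse q) *s E (Suc i) x"
    using i r_nonzero
    by (subst G_quadratic) (simp_all add: EE_down E_G_E E_E_E_invariant[OF i inv])
  finally show ?thesis .
qed

end

section \<open>Extending invariance by one strand\<close>

context bwm_operators
begin

text \<open>
  These are the two parts of the factor in the recursion for the symmetrizer, acting on \<open>x\<close>: the
  sum over \<open>x g\<^sub>k g\<^sub>k\<^sub>-\<^sub>1 \<cdots>\<close> that symmetrizes in the Hecke algebra, and the sum over the terms that
  contain \<open>x e\<^sub>k \<cdots> e\<^sub>i\<close>.
\<close>

definition coset_sum :: "nat \<Rightarrow> 'v \<Rightarrow> 'v" where
  "coset_sum k x = (\<Sum>i=0..k. q ^ i *s foldr G [k + 1 - i..<k + 1] x)"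

definition contraction_sum :: "nat \<Rightarrow> 'v \<Rightarrow> 'v" where
  "contraction_sum k x =
     (\<Sum>i=1..k. q ^ (2 * (k - i) + 1) *s coset_sum (i - 1) (foldr E [i..<k + 1] x))"

lemma coset_sum_0 [simp]: "coset_sum 0 x = x"
  by (simp add: coset_sum_def)

lemma contraction_sum_0 [simp]: "contraction_sum 0 x = 0"
  by (simp add: contraction_sum_def)

lemma coset_sum_Suc: "coset_sum (Suc k) x = x + q *s coset_sum k (G (Suc k) x)"
proof -
  have "coset_sum (Suc k) x =
      x + (\<Sum>i=0..k. q ^ Suc i *s foldr G [k + 1 - i..<Suc (k + 1)] x)"
    unfolding coset_sum_def by (subst sum.atLeast0_atMost_Suc_shift) simp
  also have "(\<Sum>i=0..k. q ^ Suc i *s foldr G [k + 1 - i..<Suc (k + 1)] x) =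
      q *s coset_sum k (G (Suc k) x)"
    unfolding coset_sum_def scale_sum_right
    by (intro sum.cong refl) (simp add: upt_Suc_append)
  finally show ?thesis .
qed

text \<open>
  Together with \<open>coset_sum_Suc\<close> this replaces all manipulation of sums: both parts are obtained by
  applying the parts for \<open>k\<close> to \<open>x g\<^sub>k\<^sub>+\<^sub>1\<close> or \<open>x e\<^sub>k\<^sub>+\<^sub>1\<close>.
\<close>

lemma contraction_sum_Suc:
  "contraction_sum (Suc k) x =
     q *s coset_sum k (E (Suc k) x) + (q * q) *s contraction_sum k (E (Suc k) x)"
proof -
  have "(\<Sum>i=1..k. q ^ (2 * (Suc k - i) + 1) *s
          coset_sum (i - 1) (foldr E [i..<Suc k + 1] x)) =
      (q * q) *s contraction_sum k (E (Suc k) x)"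
    unfolding contraction_sum_def scale_sum_right
    by (intro sum.cong refl) (simp add: Suc_diff_le upt_Suc_append mult.assoc)
  then show ?thesis
    unfolding contraction_sum_def[of "Suc k"] by simp
qed

lemma coset_sum_add: "coset_sum k (x + y) = coset_sum k x + coset_sum k y"
  by (induction k arbitrary: x y) (simp_all add: coset_sum_Suc linear_simps algebra_simps)

lemma coset_sum_scale: "coset_sum k (c *s x) = c *s coset_sum k x"
  by (induction k arbitrary: x) (simp_all add: coset_sum_Suc linear_simps algebra_simps)

lemma coset_sum_diff: "coset_sum k (x - y) = coset_sum k x - coset_sum k y"
  by (metis coset_sum_add add_diff_cancel_right' diff_add_cancel)

lemmas coset_sum_linear = coset_sum_add coset_sum_diff coset_sum_scale

lemma contraction_sum_scale: "contraction_sum k (c *s x) = c *s contraction_sum k x"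
  by (induction k arbitrary: x)
     (simp_all add: contraction_sum_Suc coset_sum_linear linear_simps algebra_simps)

lemma G_coset_sum_far: "Suc k < j \<Longrightarrow> j < n \<Longrightarrow> G j (coset_sum k x) = coset_sum k (G j x)"
proof (induction k arbitrary: x)
  case (Suc k)
  then show ?case using G_far[of "Suc k" j] by (simp add: coset_sum_Suc linear_simps)
qed simp

lemma G_contraction_sum_far:
  "Suc k < j \<Longrightarrow> j < n \<Longrightarrow> G j (contraction_sum k x) = contraction_sum k (G j x)"
proof (induction k arbitrary: x)
  case (Suc k)
  then show ?case using GE_far[of "Suc k" j]
    by (simp add: contraction_sum_Suc linear_simps G_coset_sum_far)
qed (simp add: linear_simps)

lemma sum_even_powers_Suc: "1 + q * q * (\<Sum>i\<le>k. q ^ (2 * i)) = (\<Sum>i\<le>Suc k. q ^ (2 * i))"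
  unfolding sum.atMost_Suc_shift by (simp add: sum_distrib_left mult.assoc)

lemma coset_sum_invariant:
  assumes "\<And>i. 1 \<le> i \<Longrightarrow> i \<le> k \<Longrightarrow> G i x = q *s x"
  shows "coset_sum k x = (\<Sum>i\<le>k. q ^ (2 * i)) *s x"
  using assms
proof (induction k arbitrary: x)
  case (Suc k)
  have "coset_sum (Suc k) x = (1 + (q * q) * (\<Sum>i\<le>k. q ^ (2 * i))) *s x"
    using Suc by (simp add: coset_sum_Suc coset_sum_linear algebra_simps)
  also note sum_even_powers_Suc
  finally show ?case .
qed simp

lemma scaled_coset_sum_invariant:
  assumes "\<And>i. 1 \<le> i \<Longrightarrow> i \<le> k \<Longrightarrow> G i x = q *s x"
  shows "(q * (q - inverse q)) *s coset_sum k x = (q ^ (2 * Suc k) - 1) *s x"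
proof -
  have "q ^ (2 * Suc k) - 1 = (q * q - 1) * (\<Sum>i\<le>k. q ^ (2 * i))"
    using power_diff_1_eq[of "q * q" "Suc k"]
    by (simp only: power_mult power2_eq_square lessThan_Suc_atMost)
  moreover have "q * (q - inverse q) = q * q - 1" using q_nonzero by (simp add: algebra_simps)
  ultimately show ?thesis by (simp add: coset_sum_invariant[OF assms])
qed

text \<open>
  In the Hecke algebra, where all \<open>e\<^sub>i\<close> vanish, the coset sum turns invariance under
  \<open>g\<^sub>1, \<dots>, g\<^sub>k\<^sub>-\<^sub>1\<close> into invariance under \<open>g\<^sub>1, \<dots>, g\<^sub>k\<close>. Here the quadratic relation leaves a defect,
  always a multiple of \<open>x e\<^sub>k \<cdots> e\<^sub>j\<close>. For \<open>j < k\<close> the defect is inherited from \<open>x g\<^sub>k\<close>, because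
  \<open>x g\<^sub>k e\<^sub>k\<^sub>-\<^sub>1\<close> is a multiple of \<open>x e\<^sub>k e\<^sub>k\<^sub>-\<^sub>1\<close>; for \<open>j = k\<close> it comes from expanding \<open>x g\<^sub>k g\<^sub>k\<close>.
\<close>

lemma G_coset_sum:
  assumes "\<And>i. 1 \<le> i \<Longrightarrow> i < k \<Longrightarrow> G i x = q *s x" "1 \<le> j" "j \<le> k" "k < n"
  shows "G j (coset_sum k x) =
    q *s coset_sum k x - (q * inverse r * (q - inverse q)) *s foldr E [j..<k + 1] x"
  using assms
proof (induction k arbitrary: x)
  case (Suc k)
  let ?h = "q - inverse q" and ?w = "G (Suc k) x"
  show ?case
  proof (cases "j \<le> k")
    case True
    have w: "G i ?w = q *s ?w" if "1 \<le> i" "i < k" for i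
      using that Suc.prems G_far[of i "Suc k" x] by (simp add: linear_simps)
    have k: "1 \<le> k" "Suc k < n" using True Suc.prems by auto
    have "[j..<k + 1] = [j..<k] @ [k]" "[j..<Suc k + 1] = [j..<k] @ [k, Suc k]"
      using True by (simp_all add: upt_Suc_append)
    moreover have lin: "foldr E as (c *s y) = c *s foldr E as y" for as c y
      by (induction as) (simp_all add: linear_simps)
    ultimately have "foldr E [j..<Suc k + 1] x = q *s foldr E [j..<k + 1] ?w"
      using E_E_invariant[OF k] Suc.prems(1)[of k] k by simp
    moreover have "G j (coset_sum (Suc k) x) = q *s x + q *s (q *s coset_sum k ?w
        - (q * inverse r * ?h) *s foldr E [j..<k + 1] ?w)"
      using Suc.IH[OF w Suc.prems(2) True] Suc.prems True
      by (simp add: coset_sum_Suc linear_simps)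
    ultimately show ?thesis
      by (simp add: coset_sum_Suc algebra_simps)
  next
    case False
    then have j: "j = Suc k" using Suc.prems by simp
    show ?thesis
    proof (cases k)
      case 0
      then show ?thesis using Suc.prems q_nonzero
        by (simp add: coset_sum_Suc linear_simps j G_quadratic algebra_simps)
    next
      case (Suc m)
      let ?c = "coset_sum m (G (Suc m) ?w)"
      have "G (Suc k) (G (Suc m) ?w) = q *s G (Suc m) ?w"
        using braid[of "Suc m" x] Suc.prems(1)[of k] Suc.prems(4) Suc by (simp add: linear_simps)
      then have G: "G (Suc k) ?c = q *s ?c"
        using Suc.prems Suc by (simp add: G_coset_sum_far coset_sum_scale)
      have "coset_sum (Suc k) x = x + q *s (?w + q *s ?c)"
        using Suc by (simp only: coset_sum_Suc)
      then show ?thesis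
        using Suc.prems(4) q_nonzero
        by (simp add: linear_simps G j G_quadratic algebra_simps)
    qed
  qed
qed simp

text \<open>
  The contraction part has a defect proportional to the same vector, so a suitable multiple of it
  cancels the defect of the coset sum. For \<open>j < k\<close> the recursion combines the defects of both parts
  at \<open>x e\<^sub>k\<close>. For \<open>j = k\<close> both parts are unfolded twice; all vectors except \<open>x e\<^sub>k\<close> cancel, and
  the coset sum on two strands less contributes the power \<open>q\<^sup>2\<^sup>k\<close> because \<open>x e\<^sub>k\<close> is invariant
  under \<open>g\<^sub>1, \<dots>, g\<^sub>k\<^sub>-\<^sub>2\<close>.
\<close>

lemma G_contraction_sum:
  assumes "\<And>i. 1 \<le> i \<Longrightarrow> i < k \<Longrightarrow> G i x = q *s x" "1 \<le> j" "j \<le> k" "k < n"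
  shows "G j (contraction_sum k x) =
    q *s contraction_sum k x
      + (q * inverse r * (1 - r * q ^ (2 * k - 1))) *s foldr E [j..<k + 1] x"
  using assms
proof (induction k arbitrary: x)
  case (Suc k)
  let ?h = "q - inverse q" and ?w = "E (Suc k) x"
  have w: "G i ?w = q *s ?w" if "1 \<le> i" "i < k" for i
    using that Suc.prems EG_far[of i "Suc k" x] by (simp add: linear_simps)
  show ?case
  proof (cases "j \<le> k")
    case True
    have "foldr E [j..<Suc k + 1] x = foldr E [j..<k + 1] ?w"
      using True by (simp add: upt_Suc_append)
    moreover have "q *s G j (coset_sum k ?w) + (q * q) *s G j (contraction_sum k ?w) =
        q *s (q *s coset_sum k ?w + (q * q) *s contraction_sum k ?w)
        + ((q * q) * (q * inverse r * (1 - r * q ^ (2 * k - 1))) - q * (q * inverse r * ?h)) *s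
          foldr E [j..<k + 1] ?w"
      using Suc.IH[OF w Suc.prems(2) True] G_coset_sum[OF w Suc.prems(2) True] Suc.prems(4)
      by (simp add: scale_left_diff_distrib scale_right_diff_distrib scale_right_distrib ac_simps)
    moreover have "(q * q) * (q * inverse r * (1 - r * q ^ (2 * k - 1))) - q * (q * inverse r * ?h)
        = q * inverse r * (1 - r * q ^ (2 * Suc k - 1))"
    proof -
      have "q ^ (2 * Suc k - 1) = q * q * q ^ (2 * k - 1)"
        using True Suc.prems(2) by (cases k) simp_all
      then show ?thesis using q_nonzero r_nonzero by (simp add: field_simps)
    qed
    ultimately show ?thesis
      by (simp add: contraction_sum_Suc linear_simps)
  next
    case False
    then have j: "j = Suc k" using Suc.prems by simp
    show ?thesis
    proof (cases k)
      case 0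
      then show ?thesis using Suc.prems q_nonzero r_nonzero
        by (simp add: contraction_sum_Suc linear_simps j GE algebra_simps)
    next
      case (Suc m)
      let ?c = "E k ?w" and ?g = "G k ?w"
      have k: "1 \<le> k" "Suc k < n" and m: "Suc m < j" "j < n"
        using Suc Suc.prems by (auto simp: j)
      have Gw: "G j ?w = inverse r *s ?w" using GE[of "Suc k" x] k by (simp add: j)
      have Gc: "G j ?c = ?g + ?h *s ?c - ?h *s ?w"
        using G_E_E_invariant[OF k, of x] Suc.prems(1)[of k] k by (simp add: j)
      have Bg: "G j (coset_sum m ?g) = coset_sum m ?c"
        using EE_down[OF k] G_coset_sum_far[OF m] by (simp add: j)
      have Bc: "G j (coset_sum m ?c) = coset_sum m ?g + ?h *s coset_sum m ?c - ?h *s coset_sum m ?w"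
        by (simp add: G_coset_sum_far[OF m] Gc coset_sum_linear)
      \<comment> \<open>A contraction sum sees its argument only through \<open>E m\<close>, and there \<open>G j ?c\<close> agrees
        with \<open>q ?c\<close>.\<close>
      have Dc: "G j (contraction_sum m ?c) = q *s contraction_sum m ?c"
      proof (cases m)
        case 0
        then show ?thesis by (simp add: linear_simps)
      next
        case (Suc l)
        have "E m (G j ?c) = E m (q *s ?c)"
          using E_E_invariant[of m ?w] E_eq_0_if_invariant[of m ?w] w[of m] \<open>k = Suc m\<close> Suc k q_nonzero
          unfolding Gc by (simp add: linear_simps algebra_simps)
        then have "contraction_sum m (G j ?c) = contraction_sum m (q *s ?c)"
          unfolding Suc contraction_sum_Suc by simp
        then show ?thesis by (simp add: G_contraction_sum_far[OF m] contraction_sum_scale)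
      qed
      have "(q * ?h) *s coset_sum m ?w = (q ^ (2 * Suc m) - 1) *s ?w"
        by (rule scaled_coset_sum_invariant) (use w Suc in auto)
      then have Bw: "(q * q * q * ?h) *s coset_sum m ?w = (q * q * (q ^ (2 * Suc m) - 1)) *s ?w"
        by (metis mult.assoc scale_scale)
      have eq: "contraction_sum (Suc k) x = q *s (?w + q *s coset_sum m ?g)
          + (q * q) *s (q *s coset_sum m ?c + (q * q) *s contraction_sum m ?c)"
        unfolding contraction_sum_Suc[of k] unfolding Suc coset_sum_Suc contraction_sum_Suc by simp
      then have "G j (contraction_sum (Suc k) x) =
          (q * inverse r) *s ?w + (q * q + q * q * q * ?h) *s coset_sum m ?c
          + (q * q * q) *s coset_sum m ?g - (q * q * q * ?h) *s coset_sum m ?w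
          + (q * q * q * q * q) *s contraction_sum m ?c"
        by (simp add: linear_simps Gw Bg Bc Dc scale_left_distrib scale_right_diff_distrib
            scale_right_distrib ac_simps)
      also have "q * q + q * q * q * ?h = q * q * q * q"
        using q_nonzero by (simp add: algebra_simps)
      also note Bw
      also have "q * inverse r = q * q + q * q * (q ^ (2 * Suc m) - 1)
          + q * inverse r * (1 - r * q ^ (2 * Suc k - 1))"
        using q_nonzero r_nonzero by (simp add: Suc field_simps)
      also have "\<dots> *s ?w + (q * q * q * q) *s coset_sum m ?c + (q * q * q) *s coset_sum m ?g
            - (q * q * (q ^ (2 * Suc m) - 1)) *s ?w + (q * q * q * q * q) *s contraction_sum m ?c
          = q *s contraction_sum (Suc k) x
            + (q * inverse r * (1 - r * q ^ (2 * Suc k - 1))) *s ?w"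
        unfolding eq by (simp add: scale_left_distrib scale_right_distrib ac_simps)
      finally show ?thesis by (simp add: j)
    qed
  qed
qed simp

definition symmetrize :: "nat \<Rightarrow> 'v \<Rightarrow> 'v" where
  "symmetrize k x =
     coset_sum k x + ((q - inverse q) / (1 - q ^ (2 * k - 1) * r)) *s contraction_sum k x"

lemma G_symmetrize:
  assumes "\<And>i. 1 \<le> i \<Longrightarrow> i < k \<Longrightarrow> G i x = q *s x" "1 \<le> j" "j \<le> k" "k < n"
  shows "G j (symmetrize k x) = q *s symmetrize k x"
proof -
  have "2 * k - 1 = Suc (2 * (k - 1))" using assms by (cases k) auto
  then have nz: "1 - q ^ (2 * k - 1) * r \<noteq> 0"
    using r_generic[of "k - 1"] by (simp add: mult.commute)
  define c where "c = (q - inverse q) / (1 - q ^ (2 * k - 1) * r)"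
  let ?F = "foldr E [j..<k + 1] x"
  have "c * (q * inverse r * (1 - r * q ^ (2 * k - 1))) = q * inverse r * (q - inverse q)"
    using nz by (simp add: c_def mult.commute)
  then have c: "c *s (q * inverse r * (1 - r * q ^ (2 * k - 1))) *s ?F
      = (q * inverse r * (q - inverse q)) *s ?F"
    by simp
  have "G j (symmetrize k x) = G j (coset_sum k x) + c *s G j (contraction_sum k x)"
    by (simp add: symmetrize_def c_def linear_simps)
  also have "\<dots> = q *s coset_sum k x + c *s q *s contraction_sum k x"
    using G_coset_sum[of k x j] G_contraction_sum[of k x j] assms c
    by (simp add: scale_right_distrib)
  also have "\<dots> = q *s symmetrize k x"
    by (simp add: symmetrize_def c_def scale_right_distrib mult.commute)
  finally show ?thesis .
qed

lemma sum_even_powers_nonzero: "(\<Sum>i\<le>k. q ^ (2 * i)) \<noteq> 0"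
proof
  assume "(\<Sum>i\<le>k. q ^ (2 * i)) = 0"
  then have "q ^ (2 * Suc k) = 1"
    using power_diff_1_eq[of "q\<^sup>2" "Suc k"] by (simp only: lessThan_Suc_atMost power_mult) simp
  then show False using q_nonroot[of "2 * Suc k"] by simp
qed

text \<open>
  The functional \<open>f\<close> plays the part of the character \<open>g\<^sub>i \<mapsto> q\<close>, \<open>e\<^sub>i \<mapsto> 0\<close>. It controls the
  normalization and shows that symmetrizing does not produce zero.
\<close>

context
  fixes f :: "'v \<Rightarrow> 'k"
  assumes f_add: "f (x + y) = f x + f y" and f_scale: "f (c *s x) = c * f x"
    and f_G: "1 \<le> i \<Longrightarrow> i < n \<Longrightarrow> f (G i x) = q * f x"
    and f_E: "1 \<le> i \<Longrightarrow> i < n \<Longrightarrow> f (E i x) = 0"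
begin

lemma functional_coset_sum: "k < n \<Longrightarrow> f (coset_sum k x) = (\<Sum>i\<le>k. q ^ (2 * i)) * f x"
proof (induction k arbitrary: x)
  case (Suc k)
  from arg_cong[OF sum_even_powers_Suc[of k], of "\<lambda>c. c * f x"] show ?case
    using Suc by (simp add: coset_sum_Suc f_add f_scale f_G algebra_simps)
qed simp

lemma functional_contraction_sum: "k < n \<Longrightarrow> f (contraction_sum k x) = 0"
proof (induction k arbitrary: x)
  case 0
  then show ?case using f_scale[of 0 0] by simp
next
  case (Suc k)
  then show ?case
    by (simp add: contraction_sum_Suc f_add f_scale f_E functional_coset_sum)
qed

lemma functional_symmetrize: "k < n \<Longrightarrow> f (symmetrize k x) = (\<Sum>i\<le>k. q ^ (2 * i)) * f x"
  by (simp add: symmetrize_def f_add f_scale functional_coset_sum functional_contraction_sum)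

lemma ex_invariant:
  assumes "k < n" and "f x0 = 1"
  shows "\<exists>x. f x = 1 \<and> (\<forall>i. 1 \<le> i \<and> i \<le> k \<longrightarrow> G i x = q *s x)"
  using assms(1)
proof (induction k)
  case 0
  then show ?case using assms(2) by auto
next
  case (Suc k)
  then obtain x where x: "f x = 1" "\<And>i. 1 \<le> i \<Longrightarrow> i \<le> k \<Longrightarrow> G i x = q *s x" by auto
  let ?c = "\<Sum>i\<le>Suc k. q ^ (2 * i)"
  let ?y = "inverse ?c *s symmetrize (Suc k) x"
  have "f ?y = 1"
    using x(1) Suc.prems sum_even_powers_nonzero[of "Suc k"]
    by (simp add: f_scale functional_symmetrize del: sum.atMost_Suc)
  moreover have "G i ?y = q *s ?y" if "1 \<le> i" "i \<le> Suc k" for i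
    using G_symmetrize[of "Suc k" x i] x(2) that Suc.prems by (simp add: linear_simps mult.commute)
  ultimately show ?case by blast
qed

end

end

section \<open>The free algebra and its character\<close>

lemma free_carrier_add: "x \<in> free_carrier n \<Longrightarrow> y \<in> free_carrier n \<Longrightarrow> x + y \<in> free_carrier n"
  and free_carrier_mult: "x \<in> free_carrier n \<Longrightarrow> y \<in> free_carrier n \<Longrightarrow> x * y \<in> free_carrier n"
  and free_carrier_0: "0 \<in> free_carrier n"
  and free_carrier_1: "1 \<in> free_carrier n"
  using ring.ring_simprules(1,5,2,6)[OF ring_free_alg[of n]] by (simp_all add: free_alg_def)

lemma free_carrier_minus: "x \<in> free_carrier n \<Longrightarrow> y \<in> free_carrier n \<Longrightarrow> x - y \<in> free_carrier n"
  using ring.ring_simprules(4)[OF ring_free_alg[of n], of x y] minus_free_alg[of x n y]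
  by (simp add: free_alg_def)

lemma free_carrier_sum: "(\<And>i. i \<in> A \<Longrightarrow> f i \<in> free_carrier n) \<Longrightarrow> sum f A \<in> free_carrier n"
  by (induction A rule: infinite_finite_induct) (auto simp: free_carrier_0 free_carrier_add)

lemma free_scalar_0: "free_scalar 0 = 0"
  and free_scalar_1: "free_scalar 1 = 1"
  and free_scalar_add: "free_scalar (a + b) = free_scalar a + free_scalar b"
  and free_scalar_mult: "free_scalar (a * b) = free_scalar a * free_scalar b"
  by (simp_all add: free_scalar_def single_add mult_single)

lemma poly_mapping_eq_sum:
  "x = (\<Sum>w\<in>Poly_Mapping.keys x. Poly_Mapping.single w (Poly_Mapping.lookup x w))"
  by (rule poly_mapping_eqI) (auto simp: lookup_sum lookup_single when_def in_keys_iff)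

lemma bwm_free_induct:
  assumes "\<And>w c. P (Poly_Mapping.single w c)"
    and "\<And>x y. P x \<Longrightarrow> P y \<Longrightarrow> P (x + y)"
  shows "P (x :: bwm_free)"
proof -
  have "P (\<Sum>w\<in>A. Poly_Mapping.single w (Poly_Mapping.lookup x w))" if "finite A" for A
    using that assms(1)[of 0 0] by (induction A) (auto intro: assms)
  from this[OF finite_keys[of x]] show ?thesis unfolding poly_mapping_eq_sum[symmetric] .
qed

lemma free_scalar_central: "x * free_scalar c = free_scalar c * x"
  by (induction x rule: bwm_free_induct)
     (simp_all add: free_scalar_def mult_single mult.commute algebra_simps)

text \<open>
  Scalars form central elements of the free algebra. A separate operation for multiplying with them
  allows scalars to be moved out of products by simplification.
\<close>

definition free_scale :: "complex \<Rightarrow> bwm_free \<Rightarrow> bwm_free" where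
  "free_scale c x = free_scalar c * x"

interpretation free_scale: vector_space free_scale
  by unfold_locales
     (simp_all add: free_scale_def free_scalar_add free_scalar_mult free_scalar_1 algebra_simps)

lemma free_scale_mult:
  "free_scale c x * y = free_scale c (x * y)"
  "x * free_scale c y = free_scale c (x * y)"
  by (simp_all add: free_scale_def mult.assoc flip: free_scalar_central)

lemma free_carrier_scale: "x \<in> free_carrier n \<Longrightarrow> free_scale c x \<in> free_carrier n"
  by (simp add: free_scale_def free_carrier_mult free_scalar_in_carrier)

lemmas free_carrier_closed = free_carrier_add free_carrier_mult free_carrier_0 free_carrier_1
  free_carrier_minus free_carrier_sum free_carrier_scale free_g_in_carrier free_e_in_carrier

lemma free_carrier_induct [consumes 1, case_names g e one scale add mult]:
  assumes "x \<in> free_carrier n"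
    and g: "\<And>i. 1 \<le> i \<Longrightarrow> i < n \<Longrightarrow> P (free_g i)"
    and e: "\<And>i. 1 \<le> i \<Longrightarrow> i < n \<Longrightarrow> P (free_e i)"
    and one: "P 1"
    and scale: "\<And>c x. x \<in> free_carrier n \<Longrightarrow> P x \<Longrightarrow> P (free_scale c x)"
    and add: "\<And>x y. x \<in> free_carrier n \<Longrightarrow> y \<in> free_carrier n \<Longrightarrow> P x \<Longrightarrow> P y \<Longrightarrow> P (x + y)"
    and mult: "\<And>x y. x \<in> free_carrier n \<Longrightarrow> y \<in> free_carrier n \<Longrightarrow> P x \<Longrightarrow> P y \<Longrightarrow> P (x * y)"
  shows "P x"
proof -
  have word: "Poly_Mapping.single (Word as) 1 \<in> free_carrier n \<and> P (Poly_Mapping.single (Word as) 1)"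
    if "\<forall>a\<in>set as. 1 \<le> gen_index a \<and> gen_index a < n" for as
    using that
  proof (induction as)
    case Nil
    then show ?case using one free_carrier_1[of n] by (simp add: zero_bwm_word_def flip: single_one)
  next
    case (Cons a as)
    have eq: "Poly_Mapping.single (Word (a # as)) (1::complex) =
        Poly_Mapping.single (Word [a]) 1 * Poly_Mapping.single (Word as) 1"
      by (simp add: mult_single plus_bwm_word_def)
    have "Poly_Mapping.single (Word [a]) 1 \<in> free_carrier n \<and> P (Poly_Mapping.single (Word [a]) 1)"
      using Cons.prems g e free_g_in_carrier free_e_in_carrier
      by (cases a) (auto simp: free_g_def free_e_def)
    then show ?case unfolding eq using Cons mult by (simp add: free_carrier_mult)
  qed
  have zero: "P 0" using scale[OF free_carrier_1 one, of 0] by (simp add: free_scale_def free_scalar_0)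
  have "(\<Sum>w\<in>A. Poly_Mapping.single w (Poly_Mapping.lookup x w)) \<in> free_carrier n \<and>
      P (\<Sum>w\<in>A. Poly_Mapping.single w (Poly_Mapping.lookup x w))"
    if "finite A" "A \<subseteq> Poly_Mapping.keys x" for A
    using that
  proof (induction A)
    case empty
    then show ?case by (simp add: zero free_carrier_0)
  next
    case (insert w A)
    have "w \<in> Poly_Mapping.keys x" using insert by blast
    then have "\<forall>a\<in>set (letters w). 1 \<le> gen_index a \<and> gen_index a < n"
      using assms(1) by (simp add: free_carrier_def)
    from word[OF this] have "Poly_Mapping.single w 1 \<in> free_carrier n" "P (Poly_Mapping.single w 1)"
      by simp_all
    then have "free_scale c (Poly_Mapping.single w 1) \<in> free_carrier n"
      "P (free_scale c (Poly_Mapping.single w 1))" for c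
      by (simp_all add: scale free_carrier_scale)
    then have "Poly_Mapping.single w c \<in> free_carrier n" "P (Poly_Mapping.single w c)" for c
      by (simp_all add: free_scale_def free_scalar_def mult_single)
    then show ?case using insert by (simp add: add free_carrier_add)
  qed
  from this[OF finite_keys[of x]] show ?thesis unfolding poly_mapping_eq_sum[symmetric] by blast
qed

definition word_weight :: "complex \<Rightarrow> bwm_word \<Rightarrow> complex" where
  "word_weight q w = (\<Prod>a\<leftarrow>letters w. case a of G _ \<Rightarrow> q | E _ \<Rightarrow> 0)"

text \<open>
  The character of the free algebra with \<open>g\<^sub>i \<mapsto> q\<close> and \<open>e\<^sub>i \<mapsto> 0\<close>. It kills all relators, and is
  the eigenvalue by which the algebra acts on the symmetrizer.
\<close>

definition sym_char :: "complex \<Rightarrow> bwm_free \<Rightarrow> complex" where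
  "sym_char q x = (\<Sum>w\<in>Poly_Mapping.keys x. Poly_Mapping.lookup x w * word_weight q w)"

lemma sym_char_single: "sym_char q (Poly_Mapping.single w c) = c * word_weight q w"
  by (simp add: sym_char_def)

lemma sym_char_add: "sym_char q (x + y) = sym_char q x + sym_char q y"
  unfolding sym_char_def
  by (rule setsum_keys_plus_distrib) (simp_all add: distrib_right)

lemma sym_char_mult: "sym_char q (x * y) = sym_char q x * sym_char q y"
proof -
  have single: "sym_char q (Poly_Mapping.single w c * y) = c * word_weight q w * sym_char q y" for w c
    by (induction y rule: bwm_free_induct)
       (simp_all add: mult_single sym_char_single sym_char_add algebra_simps word_weight_def
          plus_bwm_word_def)
  show ?thesis
    by (induction x rule: bwm_free_induct)
       (simp_all add: single sym_char_single sym_char_add algebra_simps)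
qed

lemma sym_char_1: "sym_char q 1 = 1"
  using sym_char_single[of q 0 1]
  by (simp only: single_one) (simp add: word_weight_def zero_bwm_word_def)

lemma sym_char_scalar: "sym_char q (free_scalar c) = c"
  by (simp add: free_scalar_def sym_char_single word_weight_def zero_bwm_word_def)

lemma sym_char_scale: "sym_char q (free_scale c x) = c * sym_char q x"
  by (simp add: free_scale_def sym_char_mult sym_char_scalar)

lemma sym_char_g: "sym_char q (free_g i) = q"
  by (simp add: free_g_def sym_char_single word_weight_def)

lemma sym_char_e: "sym_char q (free_e i) = 0"
  by (simp add: free_e_def sym_char_single word_weight_def)

lemma sym_char_diff: "sym_char q (x - y) = sym_char q x - sym_char q y"
  by (metis sym_char_add add_diff_cancel_right' diff_add_cancel)

lemmas sym_char_simps = sym_char_add sym_char_diff sym_char_mult sym_char_1 sym_char_scalar sym_char_scale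
  sym_char_g sym_char_e

lemma a_inv_free_alg:
  assumes "x \<in> free_carrier n"
  shows "\<ominus>\<^bsub>free_alg n\<^esub> x = - x"
proof -
  interpret ring "free_alg n" by (rule ring_free_alg)
  show ?thesis
    using assms free_carrier_minus[OF free_carrier_0, of x n]
    by (intro minus_equality) (simp_all add: free_alg_def)
qed

lemma sym_char_bwm_ideal:
  assumes "q \<noteq> 0" "x \<in> bwm_ideal q r n"
  shows "sym_char q x = 0"
proof -
  interpret F: ring "free_alg n" by (rule ring_free_alg)
  let ?K = "{x \<in> free_carrier n. sym_char q x = 0}"
  have 0: "sym_char q 0 = 0" by (simp add: sym_char_def)
  have "ideal ?K (free_alg n)"
  proof (rule idealI)
    show "ring (free_alg n)" by (rule ring_free_alg)
    show "subgroup ?K (add_monoid (free_alg n))"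
    proof (rule F.add.subgroupI)
      show "?K \<subseteq> carrier (free_alg n)" by (auto simp: free_alg_def)
      show "?K \<noteq> {}" using free_carrier_0 0 by blast
      show "\<ominus>\<^bsub>free_alg n\<^esub> x \<in> ?K" if "x \<in> ?K" for x
        using that sym_char_diff[of q 0 x] 0 free_carrier_minus[OF free_carrier_0, of x n]
        by (simp add: a_inv_free_alg)
      show "x \<oplus>\<^bsub>free_alg n\<^esub> y \<in> ?K" if "x \<in> ?K" "y \<in> ?K" for x y
        using that by (simp add: free_alg_def free_carrier_add sym_char_add)
    qed
  next
    fix a x assume "a \<in> ?K" "x \<in> carrier (free_alg n)"
    then show "x \<otimes>\<^bsub>free_alg n\<^esub> a \<in> ?K" "a \<otimes>\<^bsub>free_alg n\<^esub> x \<in> ?K"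
      by (simp_all add: free_alg_def free_carrier_mult sym_char_mult)
  qed
  moreover have "sym_char q x = 0" if "x \<in> bwm_relators q r n" for x
    using that \<open>q \<noteq> 0\<close> unfolding bwm_relators_def
    by (elim UnE; clarsimp simp: sym_char_simps q_hat_def; simp add: field_simps)
  then have "bwm_relators q r n \<subseteq> ?K" using bwm_relators_subset by blast
  ultimately have "bwm_ideal q r n \<subseteq> ?K"
    unfolding bwm_ideal_def by (intro F.genideal_minimal)
  then show ?thesis using assms by blast
qed

section \<open>Classes and their representatives\<close>

lemma
  shows bwm_ideal_subset: "x \<in> bwm_ideal q r n \<Longrightarrow> x \<in> free_carrier n"
    and bwm_ideal_0: "0 \<in> bwm_ideal q r n"
    and bwm_ideal_add:
      "x \<in> bwm_ideal q r n \<Longrightarrow> y \<in> bwm_ideal q r n \<Longrightarrow> x + y \<in> bwm_ideal q r n"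
    and bwm_ideal_mult_left:
      "x \<in> bwm_ideal q r n \<Longrightarrow> a \<in> free_carrier n \<Longrightarrow> a * x \<in> bwm_ideal q r n"
proof -
  interpret ideal "bwm_ideal q r n" "free_alg n" by (rule ideal_bwm_ideal)
  show "x \<in> bwm_ideal q r n \<Longrightarrow> x \<in> free_carrier n"
    using a_Hcarr by (simp add: free_alg_def)
  show "0 \<in> bwm_ideal q r n" using additive_subgroup.zero_closed[OF is_additive_subgroup]
    by (simp add: free_alg_def)
  show "x + y \<in> bwm_ideal q r n" if "x \<in> bwm_ideal q r n" "y \<in> bwm_ideal q r n"
    using additive_subgroup.a_closed[OF is_additive_subgroup that] by (simp add: free_alg_def)
  show "a * x \<in> bwm_ideal q r n" if "x \<in> bwm_ideal q r n" "a \<in> free_carrier n"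
    using I_l_closed[of x a] that by (simp add: free_alg_def)
qed

lemma
  shows bwm_class_0: "bwm_class q r n 0 = \<zero>\<^bsub>BWM q r n\<^esub>"
    and bwm_class_1: "bwm_class q r n 1 = \<one>\<^bsub>BWM q r n\<^esub>"
    and bwm_class_closed: "x \<in> free_carrier n \<Longrightarrow> bwm_class q r n x \<in> carrier (BWM q r n)"
    and bwm_class_add: "x \<in> free_carrier n \<Longrightarrow> y \<in> free_carrier n \<Longrightarrow>
      bwm_class q r n (x + y) = bwm_class q r n x \<oplus>\<^bsub>BWM q r n\<^esub> bwm_class q r n y"
    and bwm_class_mult: "x \<in> free_carrier n \<Longrightarrow> y \<in> free_carrier n \<Longrightarrow>
      bwm_class q r n (x * y) = bwm_class q r n x \<otimes>\<^bsub>BWM q r n\<^esub> bwm_class q r n y"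
proof -
  interpret ideal "bwm_ideal q r n" "free_alg n" by (rule ideal_bwm_ideal)
  have "ring_hom_ring (free_alg n) (BWM q r n) (bwm_class q r n)"
    using rcos_ring_hom_ring unfolding BWM_def bwm_class_def .
  then interpret hom: ring_hom_ring "free_alg n" "BWM q r n" "bwm_class q r n" .
  show "bwm_class q r n 0 = \<zero>\<^bsub>BWM q r n\<^esub>" "bwm_class q r n 1 = \<one>\<^bsub>BWM q r n\<^esub>"
    using hom.hom_zero hom.hom_one by (simp_all add: free_alg_def)
  show "x \<in> free_carrier n \<Longrightarrow> bwm_class q r n x \<in> carrier (BWM q r n)"
    using hom.hom_closed[of x] by (simp add: free_alg_def)
  assume "x \<in> free_carrier n" "y \<in> free_carrier n"
  then show "bwm_class q r n (x + y) = bwm_class q r n x \<oplus>\<^bsub>BWM q r n\<^esub> bwm_class q r n y"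
    "bwm_class q r n (x * y) = bwm_class q r n x \<otimes>\<^bsub>BWM q r n\<^esub> bwm_class q r n y"
    using hom.hom_add[of x y] hom.hom_mult[of x y] by (simp_all add: free_alg_def)
qed

lemma bwm_class_scale:
  "x \<in> free_carrier n \<Longrightarrow> bwm_class q r n (free_scale c x) = bwm_scale q r n c (bwm_class q r n x)"
  by (simp add: free_scale_def bwm_scale_def bwm_class_mult free_scalar_in_carrier)

lemma bwm_class_sum:
  assumes "finite A" "\<And>i. i \<in> A \<Longrightarrow> f i \<in> free_carrier n"
    and "\<And>i. i \<in> A \<Longrightarrow> bwm_class q r n (f i) = h i"
  shows "bwm_class q r n (sum f A) = (\<Oplus>\<^bsub>BWM q r n\<^esub>i\<in>A. h i)"
proof -
  interpret ring "BWM q r n" by (rule ring_BWM)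
  have "h i \<in> carrier (BWM q r n)" if "i \<in> A" for i
    using assms(2,3)[OF that] bwm_class_closed by metis
  with assms show ?thesis
    by (induction A) (simp_all add: bwm_class_0 bwm_class_add free_carrier_sum Pi_def)
qed

lemma carrier_BWM: "carrier (BWM q r n) = bwm_class q r n ` free_carrier n"
  unfolding BWM_def FactRing_def A_RCOSETS_defs a_r_coset_def bwm_class_def
  by (auto simp: free_alg_def)

definition desc_word :: "(nat \<Rightarrow> bwm_free) \<Rightarrow> nat \<Rightarrow> nat \<Rightarrow> bwm_free" where
  "desc_word x a b = prod_list (map x (rev [a..<b]))"

lemma prod_list_closed:
  "(\<And>i. i \<in> set as \<Longrightarrow> x i \<in> free_carrier n) \<Longrightarrow> prod_list (map x as) \<in> free_carrier n"
  by (induction as) (auto simp: free_carrier_1 free_carrier_mult)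

lemma desc_word_closed:
  assumes "\<And>i. 1 \<le> i \<Longrightarrow> i < n \<Longrightarrow> x i \<in> free_carrier n" "1 \<le> a" "b \<le> n"
  shows "desc_word x a b \<in> free_carrier n"
  unfolding desc_word_def using assms by (intro prod_list_closed) auto

lemma bwm_class_desc_word:
  assumes "\<And>i. 1 \<le> i \<Longrightarrow> i < n \<Longrightarrow> x i \<in> free_carrier n" "1 \<le> a" "b \<le> n"
  shows "bwm_class q r n (desc_word x a b) = desc_prod (BWM q r n) (\<lambda>i. bwm_class q r n (x i)) a b"
proof -
  have "bwm_class q r n (prod_list (map x as)) =
      foldr (\<lambda>i y. bwm_class q r n (x i) \<otimes>\<^bsub>BWM q r n\<^esub> y) as \<one>\<^bsub>BWM q r n\<^esub>"
    if "\<And>i. i \<in> set as \<Longrightarrow> x i \<in> free_carrier n" for as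
    using that by (induction as) (simp_all add: bwm_class_1 bwm_class_mult prod_list_closed)
  from this[of "rev [a..<b]"] show ?thesis
    unfolding desc_word_def desc_prod_def using assms by simp
qed

text \<open>
  A linear complement of the ideal inside the algebra on \<open>n\<close> strands gives linear representatives of
  the classes. The map is extended to all of the type by first projecting to the subalgebra.
\<close>

lemma ex_bwm_normal_form:
  "\<exists>P. Vector_Spaces.linear free_scale free_scale P \<and> (\<forall>x. P x \<in> free_carrier n) \<and>
     (\<forall>x\<in>free_carrier n. P x - x \<in> bwm_ideal q r n) \<and> (\<forall>x\<in>bwm_ideal q r n. P x = 0) \<and>
     (\<forall>x. P (P x) = P x)"
proof -
  interpret vector_space_pair free_scale free_scale ..
  have "free_scale.subspace (free_carrier n)"
    by (simp add: free_scale.subspace_def free_carrier_closed)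
  from linear_exists_left_inverse_on[OF free_scale.linear_ident this]
  obtain h where h: "range h \<subseteq> free_carrier n" "Vector_Spaces.linear free_scale free_scale h"
    "\<forall>v\<in>free_carrier n. h v = v" by auto
  have "free_scale.subspace (bwm_ideal q r n)"
    by (auto simp: free_scale.subspace_def free_scale_def free_scalar_in_carrier
        intro: bwm_ideal_add bwm_ideal_0 bwm_ideal_mult_left)
  from linear_exists_left_inverse_on[OF free_scale.linear_ident this]
  obtain p where p: "range p \<subseteq> bwm_ideal q r n" "Vector_Spaces.linear free_scale free_scale p"
    "\<forall>v\<in>bwm_ideal q r n. p v = v" by auto
  let ?P = "\<lambda>x. h x - p (h x)"
  have lin: "Vector_Spaces.linear free_scale free_scale ?P"
    using h(2) p(2) by (auto simp: Vector_Spaces.linear_iff algebra_simps)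
  have in_ideal: "p x \<in> bwm_ideal q r n" for x using p(1) by auto
  have in_carrier: "h x \<in> free_carrier n" for x using h(1) by auto
  have "p (x - y) = p x - p y" "h (x - y) = h x - h y" for x y
    using linear_diff[OF h(2)] linear_diff[OF p(2)] by auto
  moreover have "h (p (h x)) = p (h x)" for x
    using h(3) in_ideal bwm_ideal_subset by blast
  ultimately have "?P (?P x) = ?P x" for x
    using h(3) p(3) in_ideal in_carrier bwm_ideal_subset by (simp add: free_carrier_minus)
  moreover have "?P x \<in> free_carrier n" for x
    by (rule free_carrier_minus[OF in_carrier bwm_ideal_subset[OF in_ideal]])
  moreover have "free_scale (- 1) (p x) \<in> bwm_ideal q r n" for x
    unfolding free_scale_def by (rule bwm_ideal_mult_left[OF in_ideal free_scalar_in_carrier])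
  then have "?P x - x \<in> bwm_ideal q r n" if "x \<in> free_carrier n" for x
    using h(3) that by simp
  moreover have "?P x = 0" if "x \<in> bwm_ideal q r n" for x
    using that h(3) p(3) bwm_ideal_subset by simp
  ultimately show ?thesis using lin by blast
qed

definition normal_form :: "complex \<Rightarrow> complex \<Rightarrow> nat \<Rightarrow> bwm_free \<Rightarrow> bwm_free" where
  "normal_form q r n = (SOME P. Vector_Spaces.linear free_scale free_scale P \<and> (\<forall>x. P x \<in> free_carrier n) \<and>
     (\<forall>x\<in>free_carrier n. P x - x \<in> bwm_ideal q r n) \<and> (\<forall>x\<in>bwm_ideal q r n. P x = 0) \<and>
     (\<forall>x. P (P x) = P x))"

lemma
  shows normal_form_add: "normal_form q r n (x + y) = normal_form q r n x + normal_form q r n y"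
    and normal_form_scale: "normal_form q r n (free_scale c x) = free_scale c (normal_form q r n x)"
    and normal_form_diff: "normal_form q r n (x - y) = normal_form q r n x - normal_form q r n y"
    and normal_form_closed: "normal_form q r n x \<in> free_carrier n"
    and normal_form_normal_form [simp]: "normal_form q r n (normal_form q r n x) = normal_form q r n x"
    and bwm_class_normal_form: "x \<in> free_carrier n \<Longrightarrow>
      bwm_class q r n (normal_form q r n x) = bwm_class q r n x"
    and normal_form_eqI: "x \<in> free_carrier n \<Longrightarrow> y \<in> free_carrier n \<Longrightarrow>
      bwm_class q r n x = bwm_class q r n y \<Longrightarrow> normal_form q r n x = normal_form q r n y"
proof -
  interpret vector_space_pair free_scale free_scale ..
  note P = someI_ex[OF ex_bwm_normal_form[of n q r], folded normal_form_def]
  show "normal_form q r n (x + y) = normal_form q r n x + normal_form q r n y"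
    "normal_form q r n (free_scale c x) = free_scale c (normal_form q r n x)"
    using P by (simp_all add: linear_add linear_scale)
  show diff: "normal_form q r n (x - y) = normal_form q r n x - normal_form q r n y" for x y
    using P by (simp add: linear_diff)
  show "normal_form q r n x \<in> free_carrier n"
    "normal_form q r n (normal_form q r n x) = normal_form q r n x"
    using P by blast+
  show "bwm_class q r n (normal_form q r n x) = bwm_class q r n x" if "x \<in> free_carrier n"
    using P that by (simp add: bwm_class_eq_iff)
  show "normal_form q r n x = normal_form q r n y"
    if "x \<in> free_carrier n" "y \<in> free_carrier n" "bwm_class q r n x = bwm_class q r n y"
  proof -
    have "x - y \<in> bwm_ideal q r n" using that by (simp add: bwm_class_eq_iff)
    then have "normal_form q r n (x - y) = 0" using P by blast
    then show ?thesis by (simp add: diff)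
  qed
qed

lemma normal_form_eqD:
  assumes "x \<in> free_carrier n" "y \<in> free_carrier n" "normal_form q r n x = normal_form q r n y"
  shows "bwm_class q r n x = bwm_class q r n y"
  using assms bwm_class_normal_form by metis

section \<open>Left and right multiplication as operators\<close>

lemma bwm_class_relations:
  shows "1 \<le> i \<Longrightarrow> Suc i < n \<Longrightarrow> bwm_class q r n (free_g i * free_g (Suc i) * free_g i) =
      bwm_class q r n (free_g (Suc i) * free_g i * free_g (Suc i))"
      (is "PROP ?braid")
    and "1 \<le> i \<Longrightarrow> Suc i < j \<Longrightarrow> j < n \<Longrightarrow>
      bwm_class q r n (free_g i * free_g j) = bwm_class q r n (free_g j * free_g i)"
      (is "PROP ?far")
    and "1 \<le> i \<Longrightarrow> i < n \<Longrightarrow> bwm_class q r n (free_g i * free_g i) = bwm_class q r n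
      (1 + free_scale (q - inverse q) (free_g i) - free_scale (inverse r * (q - inverse q)) (free_e i))"
      (is "PROP ?quadratic")
    and "1 \<le> i \<Longrightarrow> i < n \<Longrightarrow>
      bwm_class q r n (free_g i * free_e i) = bwm_class q r n (free_scale (inverse r) (free_e i))"
      (is "PROP ?ge")
    and "1 \<le> i \<Longrightarrow> i < n \<Longrightarrow>
      bwm_class q r n (free_e i * free_g i) = bwm_class q r n (free_scale (inverse r) (free_e i))"
      (is "PROP ?eg")
    and "1 \<le> i \<Longrightarrow> Suc i < n \<Longrightarrow> bwm_class q r n (free_g i * free_g (Suc i) * free_e i) =
      bwm_class q r n (free_e (Suc i) * free_e i)"
      (is "PROP ?up")
    and "1 \<le> i \<Longrightarrow> Suc i < n \<Longrightarrow> bwm_class q r n (free_g (Suc i) * free_g i * free_e (Suc i)) =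
      bwm_class q r n (free_e i * free_e (Suc i))"
      (is "PROP ?down")
proof -
  have rel: "bwm_class q r n x = bwm_class q r n y"
    if "x - y \<in> bwm_relators q r n" "x \<in> free_carrier n" "y \<in> free_carrier n" for x y
  proof -
    interpret ring "free_alg n" by (rule ring_free_alg)
    have "bwm_relators q r n \<subseteq> bwm_ideal q r n"
      unfolding bwm_ideal_def using bwm_relators_subset
      by (intro genideal_self) (simp add: free_alg_def)
    then show ?thesis using that by (auto simp: bwm_class_eq_iff)
  qed
  show "PROP ?braid"
    by (rule rel) (auto simp: bwm_relators_def free_carrier_closed)
  show "PROP ?far"
  proof (rule rel)
    assume ij: "1 \<le> i" "Suc i < j" "j < n"
    have "free_g i * free_g j - free_g j * free_g i \<in> {free_g i * free_g j - free_g j * free_g i | i j.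
        1 \<le> i \<and> i < n \<and> 1 \<le> j \<and> j < n \<and> \<bar>int i - int j\<bar> > 1}"
      using ij by (intro CollectI exI[of _ i] exI[of _ j]) simp
    then show "free_g i * free_g j - free_g j * free_g i \<in> bwm_relators q r n"
      unfolding bwm_relators_def by blast
  qed (simp_all add: free_carrier_closed)
  show "PROP ?quadratic"
    by (rule rel) (auto simp: bwm_relators_def free_scale_def q_hat_def free_carrier_closed
        free_scalar_in_carrier)
  show "PROP ?ge" "PROP ?eg"
    by (rule rel; auto simp: bwm_relators_def free_scale_def free_carrier_closed free_scalar_in_carrier)+
  show "PROP ?up" "PROP ?down"
    by (rule rel; auto simp: bwm_relators_def free_carrier_closed)+
qed

text \<open>
  The condition on \<open>r\<close> says that the denominators \<open>1 - q\<^sup>2\<^sup>k\<^sup>-\<^sup>1 r\<close> with \<open>k \<ge> 1\<close> do not vanish. Its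
  first instance \<open>r q \<noteq> 1\<close> also separates the eigenvalue \<open>q\<close> of \<open>g\<^sub>i\<close> from the eigenvalue
  \<open>inverse r\<close> that belongs to \<open>e\<^sub>i\<close>.
\<close>

locale bwm_parameters =
  fixes q r :: complex
  assumes q_nonzero: "q \<noteq> 0" and r_nonzero: "r \<noteq> 0"
    and q_nonroot: "k > 0 \<Longrightarrow> q ^ k \<noteq> 1"
    and r_generic: "r * q ^ Suc (2 * k) \<noteq> 1"
begin

lemma sym_char_eqI:
  assumes "x \<in> free_carrier n" "y \<in> free_carrier n" "bwm_class q r n x = bwm_class q r n y"
  shows "sym_char q x = sym_char q y"
  using sym_char_bwm_ideal[OF q_nonzero, of "x - y" r n] assms
  by (simp add: bwm_class_eq_iff sym_char_diff)

lemma sym_char_normal_form: "x \<in> free_carrier n \<Longrightarrow> sym_char q (normal_form q r n x) = sym_char q x"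
  by (intro sym_char_eqI[where n = n] normal_form_closed bwm_class_normal_form)

text \<open>
  Taking \<open>mul\<close> to be the product or the opposite product treats right and left multiplication
  simultaneously.
\<close>

context
  fixes mul :: "bwm_free \<Rightarrow> bwm_free \<Rightarrow> bwm_free" and n :: nat
  assumes mul_cases: "mul = (\<lambda>x y. x * y) \<or> mul = (\<lambda>x y. y * x)"
begin

lemma
  shows mul_closed: "x \<in> free_carrier n \<Longrightarrow> y \<in> free_carrier n \<Longrightarrow> mul x y \<in> free_carrier n"
    and mul_assoc: "mul (mul x y) z = mul x (mul y z)"
    and mul_1: "mul x 1 = x"
    and mul_linear: "mul (x + y) z = mul x z + mul y z" "mul (x - y) z = mul x z - mul y z"
      "mul (free_scale c x) z = free_scale c (mul x z)" "mul z (x + y) = mul z x + mul z y"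
      "mul z (x - y) = mul z x - mul z y" "mul z (free_scale c x) = free_scale c (mul z x)"
    and sym_char_mul: "sym_char q (mul x y) = sym_char q x * sym_char q y"
  using mul_cases by (auto simp: free_carrier_mult mult.assoc algebra_simps free_scale_mult sym_char_mult)

lemma mul_cong:
  assumes "x \<in> free_carrier n" "y \<in> free_carrier n" "x' \<in> free_carrier n" "y' \<in> free_carrier n"
    and "bwm_class q r n x = bwm_class q r n x'" "bwm_class q r n y = bwm_class q r n y'"
  shows "bwm_class q r n (mul x y) = bwm_class q r n (mul x' y')"
  using mul_cases assms by (auto simp: bwm_class_mult)

text \<open>
  Multiplication by \<open>x\<close> on classes, transported to representatives in normal form. On the remaining
  part \<open>v - normal_form q r n v\<close> of the type, \<open>x\<close> acts by the character. As the character respects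
  the relations, they hold for all vectors of the type and not only for normal forms.
\<close>

definition act :: "bwm_free \<Rightarrow> bwm_free \<Rightarrow> bwm_free" where
  "act x v = normal_form q r n (mul (normal_form q r n v) x)
    + free_scale (sym_char q x) (v - normal_form q r n v)"

lemma normal_form_act: "normal_form q r n (act x v) = normal_form q r n (mul (normal_form q r n v) x)"
  by (simp add: act_def normal_form_add normal_form_scale normal_form_diff free_scale.scale_zero_right)

lemma act_act:
  assumes "x \<in> free_carrier n" "y \<in> free_carrier n"
  shows "act y (act x v) = act (mul x y) v"
proof -
  have "normal_form q r n (mul (normal_form q r n (mul (normal_form q r n v) x)) y) =
      normal_form q r n (mul (mul (normal_form q r n v) x) y)"
    by (intro normal_form_eqI mul_cong)
      (simp_all add: assms mul_closed normal_form_closed bwm_class_normal_form)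
  then show ?thesis
    unfolding act_def[of y] normal_form_act unfolding act_def
    by (simp add: mul_assoc sym_char_mul mult.commute)
qed

lemma act_cong:
  assumes "x \<in> free_carrier n" "y \<in> free_carrier n" "bwm_class q r n x = bwm_class q r n y"
  shows "act x v = act y v"
proof -
  have "normal_form q r n (mul (normal_form q r n v) x) = normal_form q r n (mul (normal_form q r n v) y)"
    using assms by (intro normal_form_eqI mul_cong) (simp_all add: mul_closed normal_form_closed)
  then show ?thesis using sym_char_eqI[OF assms] by (simp add: act_def)
qed

lemma act_linear:
  shows "act x (v + w) = act x v + act x w"
    and "act x (free_scale c v) = free_scale c (act x v)"
    and act_add: "act (x + y) v = act x v + act y v"
    and act_diff: "act (x - y) v = act x v - act y v"
    and act_scale: "act (free_scale c x) v = free_scale c (act x v)"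
    and act_1: "act 1 v = v"
  by (simp_all add: act_def normal_form_add normal_form_scale normal_form_diff mul_linear
      sym_char_simps mul_1 free_scale.scale_right_distrib free_scale.scale_left_distrib
      free_scale.scale_right_diff_distrib free_scale.scale_left_diff_distrib mult.commute)

text \<open>
  For the opposite product the conditions on \<open>g\<^sub>i g\<^sub>i\<^sub>+\<^sub>1 e\<^sub>i\<close> are the defining relations; for the
  product itself they are the mirrored ones supplied by \<open>braid_E\<close>.
\<close>

lemma bwm_operators_act:
  "bwm_operators free_scale (\<lambda>i. act (free_g i)) (\<lambda>i. act (free_e i)) q r n"
proof -
  note closed = mul_closed free_carrier_closed
  interpret braid_operators free_scale "\<lambda>i. act (free_g i)" "\<lambda>i. act (free_e i)" q r n
  proof unfold_locales
    fix i v assume i: "1 \<le> i" "i < n"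
    show "act (free_g i) (act (free_g i) v) = v + free_scale (q - inverse q) (act (free_g i) v)
        - free_scale (inverse r * (q - inverse q)) (act (free_e i) v)"
    proof -
      have "mul (free_g i) (free_g i) = free_g i * free_g i" using mul_cases by auto
      then show ?thesis
        using act_cong[OF _ _ bwm_class_relations(3)[OF i]] i
        by (simp add: act_act closed act_add act_diff act_scale act_1)
    qed
    show "act (free_g i) (act (free_e i) v) = free_scale (inverse r) (act (free_e i) v)"
      "act (free_e i) (act (free_g i) v) = free_scale (inverse r) (act (free_e i) v)"
      using mul_cases act_cong[OF _ _ bwm_class_relations(4)[OF i]]
        act_cong[OF _ _ bwm_class_relations(5)[OF i]] i
      by (auto simp: act_act closed simp flip: act_scale)
  next
    fix i v assume i: "1 \<le> i" "Suc i < n"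
    show "act (free_g i) (act (free_g (Suc i)) (act (free_g i) v)) =
        act (free_g (Suc i)) (act (free_g i) (act (free_g (Suc i)) v))"
      using mul_cases act_cong[OF _ _ bwm_class_relations(1)[OF i]] i
      by (auto simp: act_act closed mult.assoc)
  next
    fix i j v assume i: "1 \<le> i" "Suc i < j" "j < n"
    show "act (free_g j) (act (free_g i) v) = act (free_g i) (act (free_g j) v)"
      using mul_cases act_cong[OF _ _ bwm_class_relations(2)[OF i]] i
      by (auto simp: act_act closed)
  qed (simp_all add: act_linear q_nonzero r_nonzero q_nonroot)
  show ?thesis
  proof unfold_locales
    fix i v assume i: "1 \<le> i" "Suc i < n"
    show "act (free_g i) (act (free_g (Suc i)) (act (free_e i) v)) =
        act (free_e (Suc i)) (act (free_e i) v)"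
      using mul_cases
    proof
      assume "mul = (\<lambda>x y. y * x)"
      then have mul: "mul x y = y * x" for x y by simp
      show ?thesis
        using act_cong[OF _ _ bwm_class_relations(6)[OF i]] i
        by (simp add: act_act closed mul mult.assoc)
    next
      assume "mul = (\<lambda>x y. x * y)"
      then have mul: "mul x y = x * y" for x y by simp
      show ?thesis unfolding braid_E(1)[OF i]
        using act_cong[OF _ _ bwm_class_relations(7)[OF i]] i
        by (simp add: act_act closed mul mult.assoc)
    qed
    show "act (free_g (Suc i)) (act (free_g i) (act (free_e (Suc i)) v)) =
        act (free_e i) (act (free_e (Suc i)) v)"
      using mul_cases
    proof
      assume "mul = (\<lambda>x y. y * x)"
      then have mul: "mul x y = y * x" for x y by simp
      show ?thesis
        using act_cong[OF _ _ bwm_class_relations(7)[OF i]] i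
        by (simp add: act_act closed mul mult.assoc)
    next
      assume "mul = (\<lambda>x y. x * y)"
      then have mul: "mul x y = x * y" for x y by simp
      show ?thesis unfolding braid_E(2)[OF i]
        using act_cong[OF _ _ bwm_class_relations(6)[OF i]] i
        by (simp add: act_act closed mul mult.assoc)
    qed
  qed (rule r_generic)
qed

lemma act_normal_form:
  assumes "t \<in> free_carrier n" "x \<in> free_carrier n"
  shows "act x (normal_form q r n t) = normal_form q r n (mul t x)"
proof -
  have "normal_form q r n (mul (normal_form q r n t) x) = normal_form q r n (mul t x)"
    using assms by (intro normal_form_eqI mul_cong)
      (simp_all add: mul_closed normal_form_closed bwm_class_normal_form)
  then show ?thesis by (simp add: act_def)
qed

lemma act_normal_form_eq_scale_iff:
  assumes "t \<in> free_carrier n" "x \<in> free_carrier n"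
  shows "act x (normal_form q r n t) = free_scale c (normal_form q r n t) \<longleftrightarrow>
    bwm_class q r n (mul t x) = bwm_class q r n (free_scale c t)"
  using assms normal_form_eqI normal_form_eqD
  unfolding act_normal_form[OF assms] normal_form_scale[symmetric]
  by (meson mul_closed free_carrier_scale)

lemma sym_char_normal_form_act:
  "x \<in> free_carrier n \<Longrightarrow>
    sym_char q (normal_form q r n (act x v)) = sym_char q x * sym_char q (normal_form q r n v)"
  by (simp add: normal_form_act sym_char_normal_form mul_closed normal_form_closed sym_char_mul)

definition invariant :: "bwm_free \<Rightarrow> bool" where
  "invariant t \<longleftrightarrow> t \<in> free_carrier n \<and>
     (\<forall>i. 1 \<le> i \<and> i < n \<longrightarrow> bwm_class q r n (mul t (free_g i)) = bwm_class q r n (free_scale q t))"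

lemma invariant_scale:
  assumes "invariant t"
  shows "invariant (free_scale c t)"
proof -
  have t: "t \<in> free_carrier n" using assms by (simp add: invariant_def)
  have "bwm_class q r n (mul (free_scale c t) (free_g i)) = bwm_class q r n (free_scale q (free_scale c t))"
    if i: "1 \<le> i" "i < n" for i
  proof -
    have "bwm_class q r n (free_scale c (mul t (free_g i))) = bwm_class q r n (free_scale c (free_scale q t))"
      using bwm_class_scale[where x = "mul t (free_g i)" and c = c]
        bwm_class_scale[where x = "free_scale q t" and c = c] assms i t
      by (simp add: invariant_def mul_closed free_g_in_carrier free_carrier_scale
          del: free_scale.scale_scale)
    then show ?thesis by (simp add: mul_linear mult.commute)
  qed
  then show ?thesis using t by (simp add: invariant_def free_carrier_scale)
qed

lemma ex_normalized_invariant: "\<exists>t. invariant t \<and> sym_char q t = 1"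
proof (cases "n = 0")
  case True
  then have "invariant 1" unfolding invariant_def by (simp add: free_carrier_1)
  then show ?thesis using sym_char_1 by blast
next
  case False
  interpret bwm_operators free_scale "\<lambda>i. act (free_g i)" "\<lambda>i. act (free_e i)" q r n
    by (rule bwm_operators_act)
  have "\<exists>v. sym_char q (normal_form q r n v) = 1 \<and>
      (\<forall>i. 1 \<le> i \<and> i \<le> n - 1 \<longrightarrow> act (free_g i) v = free_scale q v)"
    using False
    by (intro ex_invariant[where ?x0.0 = 1])
       (simp_all add: normal_form_add normal_form_scale sym_char_simps sym_char_normal_form_act
          sym_char_normal_form free_carrier_closed)
  then obtain v where v: "sym_char q (normal_form q r n v) = 1"
    "\<And>i. 1 \<le> i \<Longrightarrow> i < n \<Longrightarrow> act (free_g i) v = free_scale q v" using False by force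
  have "act (free_g i) (normal_form q r n v) = free_scale q (normal_form q r n v)"
    if "1 \<le> i" "i < n" for i
    using arg_cong[OF v(2)[OF that], of "normal_form q r n"]
    unfolding normal_form_act by (simp add: act_def normal_form_scale)
  then have "bwm_class q r n (mul (normal_form q r n v) (free_g i)) =
      bwm_class q r n (free_scale q (normal_form q r n v))" if "1 \<le> i" "i < n" for i
    using that
    by (subst act_normal_form_eq_scale_iff[symmetric]) (simp_all add: normal_form_closed free_g_in_carrier)
  then have "invariant (normal_form q r n v)"
    by (simp add: invariant_def normal_form_closed)
  then show ?thesis using v(1) by blast
qed

text \<open>
  An invariant element is an eigenvector of the whole algebra. For \<open>e\<^sub>i\<close> the reason is
  \<open>q t e\<^sub>i = t g\<^sub>i e\<^sub>i = inverse r t e\<^sub>i\<close>, which forces \<open>t e\<^sub>i = 0\<close>.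
\<close>

lemma invariant_mul:
  assumes t: "invariant t" and x: "x \<in> free_carrier n"
  shows "bwm_class q r n (mul t x) = bwm_class q r n (free_scale (sym_char q x) t)"
proof -
  interpret bwm_operators free_scale "\<lambda>i. act (free_g i)" "\<lambda>i. act (free_e i)" q r n
    by (rule bwm_operators_act)
  let ?v = "normal_form q r n t"
  have t': "t \<in> free_carrier n" using t by (simp add: invariant_def)
  have G: "act (free_g i) ?v = free_scale q ?v" if "1 \<le> i" "i < n" for i
    using t that by (simp add: invariant_def act_normal_form_eq_scale_iff free_g_in_carrier)
  have "act x ?v = free_scale (sym_char q x) ?v"
    using x
  proof (induction x rule: free_carrier_induct)
    case (g i)
    then show ?case by (simp add: G sym_char_g)
  next
    case (e i)
    then show ?case using E_eq_0_if_invariant[OF e G[OF e]] by (simp add: sym_char_e)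
  next
    case (mult x y)
    then have "act (mul x y) ?v = free_scale (sym_char q x * sym_char q y) ?v"
      "act (mul y x) ?v = free_scale (sym_char q x * sym_char q y) ?v"
      by (simp_all add: act_linear mult.commute flip: act_act)
    then show ?case using mul_cases by (auto simp: sym_char_mult)
  qed (simp_all add: act_1 act_scale act_add sym_char_simps free_scale.scale_left_distrib)
  then show ?thesis using x t' by (simp add: act_normal_form_eq_scale_iff)
qed

end

end

section \<open>Uniqueness of the symmetrizer\<close>

context bwm_parameters
begin

abbreviation right_invariant :: "nat \<Rightarrow> bwm_free \<Rightarrow> bool" where
  "right_invariant \<equiv> invariant (\<lambda>x y. x * y)"

abbreviation left_invariant :: "nat \<Rightarrow> bwm_free \<Rightarrow> bool" where
  "left_invariant \<equiv> invariant (\<lambda>x y. y * x)"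

text \<open>
  Evaluate \<open>t l\<close> in two ways: it is \<open>sym_char q l\<close> times \<open>t\<close>, and \<open>sym_char q t\<close> times \<open>l\<close>. This
  gives the uniqueness of the symmetrizer, with a left invariant element as the witness to which
  all right invariant ones are compared.
\<close>

lemma right_invariant_eq_left_invariant:
  assumes "right_invariant n t" "sym_char q t = 1" "left_invariant n l" "sym_char q l = 1"
  shows "bwm_class q r n t = bwm_class q r n l"
proof -
  have "t \<in> free_carrier n" "l \<in> free_carrier n" using assms by (simp_all add: invariant_def)
  then show ?thesis
    using invariant_mul[OF _ assms(1), of l] invariant_mul[OF _ assms(3), of t] assms by simp
qed

text \<open>
  For an invariant \<open>t\<close> the square \<open>t t\<close> is \<open>sym_char q t\<close> times \<open>t\<close>, which leaves only the weight
  one for a nonzero idempotent. An invariant \<open>t\<close> of weight one is nonzero because the character is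
  well defined on classes.
\<close>

lemma is_symmetrizer_class_iff:
  assumes t: "t \<in> free_carrier n"
  shows "is_symmetrizer q r n (bwm_class q r n t) \<longleftrightarrow> right_invariant n t \<and> sym_char q t = 1"
proof -
  have inv: "right_invariant n t \<longleftrightarrow> (\<forall>i. 1 \<le> i \<and> i < n \<longrightarrow>
      bwm_class q r n t \<otimes>\<^bsub>BWM q r n\<^esub> bwm_g q r n i = bwm_scale q r n q (bwm_class q r n t))"
    using t by (simp add: invariant_def bwm_g_def bwm_class_mult bwm_class_scale free_g_in_carrier)
  have "bwm_class q r n t \<noteq> \<zero>\<^bsub>BWM q r n\<^esub> \<and>
      bwm_class q r n t \<otimes>\<^bsub>BWM q r n\<^esub> bwm_class q r n t = bwm_class q r n t \<longleftrightarrow> sym_char q t = 1"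
    if inv: "right_invariant n t"
  proof
    have sq: "bwm_class q r n (t * t) = bwm_class q r n (free_scale (sym_char q t) t)"
      using invariant_mul[OF _ inv t] by simp
    show "sym_char q t = 1"
      if "bwm_class q r n t \<noteq> \<zero>\<^bsub>BWM q r n\<^esub> \<and>
        bwm_class q r n t \<otimes>\<^bsub>BWM q r n\<^esub> bwm_class q r n t = bwm_class q r n t"
    proof -
      have "bwm_class q r n (t * t) = bwm_class q r n t"
        using that t by (simp add: bwm_class_mult)
      then have "sym_char q t * sym_char q t = sym_char q t"
        using sym_char_eqI[OF _ t, of "t * t"] t by (simp add: free_carrier_mult sym_char_mult)
      moreover have "sym_char q t \<noteq> 0"
        using that sq \<open>bwm_class q r n (t * t) = bwm_class q r n t\<close> by (auto simp: bwm_class_0)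
      ultimately show ?thesis by simp
    qed
    show "bwm_class q r n t \<noteq> \<zero>\<^bsub>BWM q r n\<^esub> \<and>
        bwm_class q r n t \<otimes>\<^bsub>BWM q r n\<^esub> bwm_class q r n t = bwm_class q r n t"
      if "sym_char q t = 1"
    proof -
      have "bwm_class q r n t \<noteq> bwm_class q r n 0"
        using sym_char_eqI[OF t free_carrier_0] that by (auto simp: sym_char_def[of q 0])
      then show ?thesis using sq that t by (simp add: bwm_class_0 bwm_class_mult)
    qed
  qed
  then show ?thesis
    unfolding is_symmetrizer_def inv[symmetric] using bwm_class_closed[OF t] by blast
qed

lemma symmetrizer_eq:
  assumes t: "right_invariant n t" "sym_char q t = 1"
  shows "symmetrizer q r n = bwm_class q r n t"
  unfolding symmetrizer_def
proof (rule the_equality)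
  show "is_symmetrizer q r n (bwm_class q r n t)"
    using t by (subst is_symmetrizer_class_iff) (auto simp: invariant_def)
next
  fix S assume S: "is_symmetrizer q r n S"
  then obtain s where s: "s \<in> free_carrier n" "S = bwm_class q r n s"
    by (auto simp: is_symmetrizer_def carrier_BWM)
  with S have "right_invariant n s" "sym_char q s = 1" by (simp_all add: is_symmetrizer_class_iff)
  moreover obtain l where "left_invariant n l" "sym_char q l = 1"
    using ex_normalized_invariant[of "\<lambda>x y. y * x"] by blast
  ultimately show "S = bwm_class q r n t"
    using right_invariant_eq_left_invariant t s(2) by metis
qed

end

section \<open>The recursion\<close>

context bwm_parameters
begin

definition contraction_word :: "nat \<Rightarrow> nat \<Rightarrow> bwm_free" where
  "contraction_word k i = desc_word free_e i k *
     (\<Sum>j\<in>{0..i - 1}. free_scale (q ^ j) (desc_word free_g (i - j) i))"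

text \<open>
  The representative of \<open>b_plus q r n k\<close> in the free algebra; it is the same for all \<open>n > k\<close>.
\<close>

definition sym_factor :: "nat \<Rightarrow> bwm_free" where
  "sym_factor k =
     (\<Sum>i\<in>{0..k}. free_scale (q ^ i) (desc_word free_g (k + 1 - i) (k + 1)))
     + free_scale (q_hat q / (1 - q powi (2 * int k - 1) * r))
         (\<Sum>i\<in>{1..k}. free_scale (q powi (2 * int k - 2 * int i + 1)) (contraction_word (k + 1) i))"

lemmas words_closed = free_carrier_add free_carrier_scale free_carrier_sum free_carrier_mult
  desc_word_closed free_g_in_carrier free_e_in_carrier

lemma contraction_word_closed:
  "1 \<le> i \<Longrightarrow> i < k \<Longrightarrow> k \<le> n \<Longrightarrow> contraction_word k i \<in> free_carrier n"
  unfolding contraction_word_def by (intro words_closed) auto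

lemma sym_factor_closed: "k < n \<Longrightarrow> sym_factor k \<in> free_carrier n"
  unfolding sym_factor_def by (intro words_closed contraction_word_closed) auto

lemma bwm_class_sym_factor:
  assumes "k < n"
  shows "bwm_class q r n (sym_factor k) = b_plus q r n k"
proof -
  have g: "bwm_class q r n (free_scale c (desc_word free_g a b)) =
      bwm_scale q r n c (desc_prod (BWM q r n) (bwm_g q r n) a b)" if "1 \<le> a" "b \<le> n" for a b c
    using that by (simp add: bwm_class_scale bwm_class_desc_word words_closed flip: bwm_g_def)
  have e: "bwm_class q r n (desc_word free_e a b) = desc_prod (BWM q r n) (bwm_e q r n) a b"
    if "1 \<le> a" "b \<le> n" for a b
    using that by (simp add: bwm_class_desc_word words_closed flip: bwm_e_def)
  have d: "bwm_class q r n (contraction_word (k + 1) i) = d_plus q r n (k + 1) i" if "i \<in> {1..k}" for i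
  proof -
    have "bwm_class q r n (\<Sum>j\<in>{0..i - 1}. free_scale (q ^ j) (desc_word free_g (i - j) i)) =
        (\<Oplus>\<^bsub>BWM q r n\<^esub>j\<in>{0..i - 1}.
          bwm_scale q r n (q ^ j) (desc_prod (BWM q r n) (bwm_g q r n) (i - j) i))"
      using that assms by (intro bwm_class_sum g words_closed) auto
    then show ?thesis
      unfolding d_plus_def contraction_word_def using that assms
      by (subst bwm_class_mult) (auto simp: e intro!: words_closed)
  qed
  have "bwm_class q r n (\<Sum>i\<in>{1..k}. free_scale (q powi (2 * int k - 2 * int i + 1))
        (contraction_word (k + 1) i)) =
      (\<Oplus>\<^bsub>BWM q r n\<^esub>i\<in>{1..k}.
          bwm_scale q r n (q powi (2 * int k - 2 * int i + 1)) (d_plus q r n (k + 1) i))"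
    using assms by (intro bwm_class_sum)
      (simp_all add: bwm_class_scale words_closed contraction_word_closed d[simplified])
  moreover have "bwm_class q r n (\<Sum>i\<in>{0..k}. free_scale (q ^ i) (desc_word free_g (k + 1 - i) (k + 1))) =
      (\<Oplus>\<^bsub>BWM q r n\<^esub>i\<in>{0..k}.
        bwm_scale q r n (q ^ i) (desc_prod (BWM q r n) (bwm_g q r n) (k + 1 - i) (k + 1)))"
    using assms by (intro bwm_class_sum g words_closed) auto
  moreover have "(\<Sum>i\<in>{1..k}. free_scale (q powi (2 * int k - 2 * int i + 1))
        (contraction_word (k + 1) i)) \<in> free_carrier n"
    "(\<Sum>i\<in>{0..k}. free_scale (q ^ i) (desc_word free_g (k + 1 - i) (k + 1))) \<in> free_carrier n"
    using assms by (intro words_closed contraction_word_closed; auto)+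
  ultimately show ?thesis
    unfolding sym_factor_def b_plus_def by (simp only: bwm_class_add bwm_class_scale free_carrier_scale)
qed

abbreviation right_act :: "nat \<Rightarrow> bwm_free \<Rightarrow> bwm_free \<Rightarrow> bwm_free" where
  "right_act \<equiv> act (\<lambda>x y. x * y)"

lemma right_act_desc_word:
  assumes "\<And>i. 1 \<le> i \<Longrightarrow> i < n \<Longrightarrow> x i \<in> free_carrier n" "1 \<le> a" "b \<le> n"
  shows "right_act n (desc_word x a b) v = foldr (\<lambda>i. right_act n (x i)) [a..<b] v"
proof -
  have "right_act n (prod_list (map x (rev as))) v = foldr (\<lambda>i. right_act n (x i)) as v"
    if "\<And>i. i \<in> set as \<Longrightarrow> x i \<in> free_carrier n" for as
    using that
  proof (induction as)
    case (Cons i as)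
    then have "right_act n (x i) (right_act n (prod_list (map x (rev as))) v) =
        right_act n (prod_list (map x (rev as)) * x i) v"
      by (intro act_act) (auto intro!: prod_list_closed)
    then show ?case using Cons by simp
  qed (simp add: act_1)
  from this[of "[a..<b]"] show ?thesis unfolding desc_word_def using assms by simp
qed

lemma right_act_sum:
  "right_act n (sum f A) v = (\<Sum>i\<in>A. right_act n (f i) v)"
proof (induction A rule: infinite_finite_induct)
  case (insert i A)
  then show ?case by (simp add: act_add)
qed (use act_diff[of "\<lambda>x y. x * y" n 0 0 v] in simp_all)

lemma right_act_sym_factor:
  assumes "1 \<le> k" "k < n"
  shows "right_act n (sym_factor k) v = bwm_operators.symmetrize free_scale
    (\<lambda>i. right_act n (free_g i)) (\<lambda>i. right_act n (free_e i)) q r k v"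
proof -
  interpret bwm_operators free_scale "\<lambda>i. right_act n (free_g i)" "\<lambda>i. right_act n (free_e i)" q r n
    by (rule bwm_operators_act) simp
  have coset: "right_act n (\<Sum>j\<in>{0..l}. free_scale (q ^ j) (desc_word free_g (l + 1 - j) (l + 1))) w
      = coset_sum l w" if "l < n" for l w
    unfolding coset_sum_def right_act_sum using that
    by (intro sum.cong refl) (simp add: act_scale right_act_desc_word words_closed)
  have "right_act n (contraction_word (k + 1) i) v =
      coset_sum (i - 1) (foldr (\<lambda>i. right_act n (free_e i)) [i..<k + 1] v)" if i: "i \<in> {1..k}" for i
  proof -
    have "right_act n (contraction_word (k + 1) i) v =
        right_act n (\<Sum>j\<in>{0..i - 1}. free_scale (q ^ j) (desc_word free_g (i - j) i))
          (right_act n (desc_word free_e i (k + 1)) v)"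
      unfolding contraction_word_def using i assms
      by (intro act_act[symmetric]) (auto intro!: words_closed)
    moreover have "i - 1 < n" using i assms by auto
    ultimately show ?thesis
      using coset[of "i - 1"] i assms by (simp add: right_act_desc_word words_closed)
  qed
  moreover have "q powi (2 * int k - 2 * int i + 1) = q ^ (2 * (k - i) + 1)" if "i \<in> {1..k}" for i
  proof -
    have "2 * int k - 2 * int i + 1 = int (2 * (k - i) + 1)" using that by simp
    then show ?thesis by (simp only: power_int_of_nat)
  qed
  ultimately have "right_act n (\<Sum>i\<in>{1..k}. free_scale (q powi (2 * int k - 2 * int i + 1))
        (contraction_word (k + 1) i)) v = contraction_sum k v"
    unfolding contraction_sum_def right_act_sum by (intro sum.cong refl) (simp add: act_scale)
  moreover have "2 * int k - 1 = int (2 * k - 1)" using assms by simp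
  then have "q powi (2 * int k - 1) = q ^ (2 * k - 1)" by (simp only: power_int_of_nat)
  ultimately show ?thesis
    unfolding sym_factor_def symmetrize_def
    using coset[OF assms(2)] by (simp add: act_add act_scale q_hat_def)
qed

lemma right_invariant_step:
  assumes m: "1 \<le> m" and t: "right_invariant m t" "sym_char q t = 1"
  defines "s \<equiv> free_scale (1 / (\<Sum>i\<le>m. q ^ (2 * i))) (t * sym_factor m)"
  shows "right_invariant (Suc m) s" "sym_char q s = 1"
proof -
  let ?n = "Suc m" and ?b = "sym_factor m"
  let ?v = "normal_form q r ?n t"
  interpret bwm_operators free_scale "\<lambda>i. right_act ?n (free_g i)" "\<lambda>i. right_act ?n (free_e i)" q r ?n
    by (rule bwm_operators_act) simp
  have t_m: "t \<in> free_carrier m" using t by (simp add: invariant_def)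
  then have t_n: "t \<in> free_carrier ?n" using free_carrier_mono[of m ?n] by auto
  have b: "?b \<in> free_carrier ?n" by (simp add: sym_factor_closed)
  have "right_act ?n (free_g i) ?v = free_scale q ?v" if "1 \<le> i" "i < m" for i
  proof -
    \<comment> \<open>The given invariance is an identity on \<open>m\<close> strands; the inclusion of ideals carries it
      over to one more strand.\<close>
    have "bwm_class q r m (t * free_g i) = bwm_class q r m (free_scale q t)"
      using t that by (simp add: invariant_def)
    then have "bwm_class q r ?n (t * free_g i) = bwm_class q r ?n (free_scale q t)"
      using bwm_ideal_mono[of m ?n q r] t_m t_n that
      by (simp add: bwm_class_eq_iff free_carrier_closed subset_iff)
    then show ?thesis using that t_n by (simp add: act_normal_form_eq_scale_iff free_g_in_carrier)
  qed
  then have "right_act ?n (free_g j) (symmetrize m ?v) = free_scale q (symmetrize m ?v)"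
    if "1 \<le> j" "j < ?n" for j
    using G_symmetrize[of m ?v j] that by simp
  moreover have sym: "symmetrize m ?v = normal_form q r ?n (t * ?b)"
    using right_act_sym_factor[OF m, of ?n ?v] act_normal_form[OF _ t_n b, of "\<lambda>x y. x * y"] by simp
  ultimately have "bwm_class q r ?n (t * ?b * free_g j) = bwm_class q r ?n (free_scale q (t * ?b))"
    if "1 \<le> j" "j < ?n" for j
    using act_normal_form_eq_scale_iff[of "\<lambda>x y. x * y" "t * ?b" ?n "free_g j" q] that t_n b
    by (simp add: free_carrier_closed)
  then have "right_invariant ?n (t * ?b)"
    using t_n b by (simp add: invariant_def free_carrier_closed)
  then show "right_invariant ?n s"
    unfolding s_def by (intro invariant_scale) simp
  have "sym_char q (normal_form q r ?n (symmetrize m ?v)) =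
      (\<Sum>i\<le>m. q ^ (2 * i)) * sym_char q (normal_form q r ?n ?v)"
    by (rule functional_symmetrize)
       (simp_all add: normal_form_add normal_form_scale sym_char_simps sym_char_normal_form_act
          free_carrier_closed)
  then show "sym_char q s = 1"
    using t(2) t_n b sum_even_powers_nonzero[of m]
    by (simp add: s_def sym sym_char_simps sym_char_normal_form free_carrier_closed del: sum.atMost_Suc)
qed

end

theorem proposition1:
  fixes q r :: complex and n :: nat
  assumes "q \<noteq> 0" and "r \<noteq> 0"
    and "\<And>k::nat. k > 0 \<Longrightarrow> q ^ k \<noteq> 1"
    and "\<And>k::int. r \<noteq> q powi k \<and> r \<noteq> - (q powi k)"
    and "n \<ge> 3"
  shows "symmetrizer q r n =
    bwm_scale q r n (1 / (q ^ (n - 1) * q_num q (int n)))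
      (bwm_embed q r (n - 1) n (symmetrizer q r (n - 1))
         \<otimes>\<^bsub>BWM q r n\<^esub> b_plus q r n (n - 1))"
proof -
  have "r * q ^ Suc (2 * k) \<noteq> 1" for k
  proof
    assume "r * q ^ Suc (2 * k) = 1"
    then have "r = q powi (- int (Suc (2 * k)))"
      using assms(1) by (simp only: power_int_minus power_int_of_nat) (simp add: field_simps)
    then show False using assms(4) by blast
  qed
  then interpret bwm_parameters q r
    using assms by unfold_locales auto
  define m where "m = n - 1"
  have n: "n = Suc m" "1 \<le> m" using assms(5) by (auto simp: m_def)
  obtain t where t: "right_invariant m t" "sym_char q t = 1"
    using ex_normalized_invariant[of "\<lambda>x y. x * y"] by blast
  have t_m: "t \<in> free_carrier m" using t by (simp add: invariant_def)
  then have t_n: "t \<in> free_carrier n" using free_carrier_mono[of m n] n by auto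
  have b: "sym_factor m \<in> free_carrier n" by (simp add: sym_factor_closed n)
  have "bwm_embed q r m n (symmetrizer q r m) = bwm_class q r n t"
    using symmetrizer_eq[OF t] bwm_embed_class[OF _ t_m] n by simp
  moreover have "symmetrizer q r n =
      bwm_class q r n (free_scale (1 / (\<Sum>i\<le>m. q ^ (2 * i))) (t * sym_factor m))"
    using symmetrizer_eq[OF right_invariant_step[OF n(2) t]] by (simp only: n)
  moreover have "(\<Sum>i\<le>m. q ^ (2 * i)) = q ^ m * q_num q (int n)"
  proof -
    have nz: "q\<^sup>2 - 1 \<noteq> 0" using assms(3)[of 2] by simp
    then have "q - inverse q \<noteq> 0" using assms(1) by (simp add: field_simps power2_eq_square)
    moreover have "q_num q (int n) = (q ^ m * q - inverse (q ^ m * q)) / (q - inverse q)"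
      unfolding q_num_def n(1) power_int_minus power_int_of_nat by simp
    ultimately have num: "(q - inverse q) * q_num q (int n) = q ^ m * q - inverse (q ^ m * q)"
      by simp
    have "(q\<^sup>2 - 1) * (q ^ m * q_num q (int n)) =
        (q ^ m * q) * ((q - inverse q) * q_num q (int n))"
      using assms(1) by (simp add: algebra_simps power2_eq_square)
    also have "\<dots> = (q ^ m * q)\<^sup>2 - 1"
      unfolding num using assms(1) by (simp add: right_diff_distrib power2_eq_square field_simps)
    finally have "(q\<^sup>2 - 1) * (q ^ m * q_num q (int n)) = (q ^ m * q)\<^sup>2 - 1" .
    moreover have "(q\<^sup>2 - 1) * (\<Sum>i\<le>m. q ^ (2 * i)) = (q ^ m * q)\<^sup>2 - 1"
      using power_diff_1_eq[of "q\<^sup>2" "Suc m"]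
      by (simp add: lessThan_Suc_atMost power_mult power_mult_distrib mult.commute flip: power_mult)
    ultimately show ?thesis using nz by (metis mult_left_cancel)
  qed
  ultimately show ?thesis
    unfolding m_def[symmetric]
    using t_n b
    by (simp only: bwm_class_scale bwm_class_mult free_carrier_mult)
      (simp add: bwm_class_sym_factor n)
qed

end
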